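(* Let $X$ be a finite-dimensional Euclidean space, let $f\colon X\to X$ be continuously differentiable around $\bar x$, and let $g\colon X\to(-\infty,\infty]$ be lower semicontinuous, and prox-regular and subdifferentially continuous at $\bar x$ for some $\hat v\in\partial g(\bar x)$. Put $T:=f+\partial g\colon X\rightrightarrows X$ and $\bar v:=f(\bar x)+\hat v$. The following are equivalent: (i) $T$ is locally strongly maximally monotone around $(\bar x,\bar v)$. (ii) The limiting coderivative $D^*T(\bar x,\bar v)$ is positive-definite in the sense that $\langle z,w\rangle>0$ whenever $z\in D^*T(\bar x,\bar v)(w)$, $w\ne0$.
   Context: Subdifferentials. $\widehat\partial g(\bar x)=\{v:\liminf_{x\to\bar x}[g(x)-g(\bar x)-\langle v,x-\bar x\rangle]/\|x-\bar x\|\ge0\}$ for $g(\bar x)<\infty$; the limiting subdifferential $\partial g(\bar x)$ is the set of limits $\lim v_k$ with $v_k\in\widehat\partial g(x_k)$, $x_k\to\bar x$, $g(x_k)\to g(\bar x)$. $g$ is prox-regular at $\bar x$ for $\hat v\in\partial g(\bar x)$ if there are neighborhoods $U$ of $\bar x$, $V$ of $\hat v$ and $\varepsilon,r>0$ such that $g(x)\ge g(u)+\langle v,x-u\rangle-\frac r2\|x-u\|^2$ for all $x\in U$ whenever $v\in\partial g(u)\cap V$, $u\in U$, $g(u)\le g(\bar x)+\varepsilon$. $g$ is subdifferentially continuous at $\bar x$ for $\hat v$ if $(x,v)\mapsto g(x)$ is continuous relative to $\mathrm{gph}\,\partial g$ at $(\bar x,\hat v)$. An operator $S\colon X\rightrightarrows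 X$ is monotone if $\langle v_1-v_2,u_1-u_2\rangle\ge0$ for all $(u_1,v_1),(u_2,v_2)\in\mathrm{gph}\,S$. $T$ is locally strongly maximally monotone around $(\bar x,\bar v)$ if there are $\kappa>0$ and a neighborhood $U\times V$ of $(\bar x,\bar v)$ such that $\langle v_1-v_2,u_1-u_2\rangle\ge\kappa\|u_1-u_2\|^2$ for all $(u_1,v_1),(u_2,v_2)\in\mathrm{gph}\,T\cap(U\times V)$, and $\mathrm{gph}\,T\cap(U\times V)=\mathrm{gph}\,S\cap(U\times V)$ for every monotone $S\colon X\rightrightarrows X$ with $\mathrm{gph}\,T\cap(U\times V)\subset\mathrm{gph}\,S$. Limiting coderivative. $\widehat N_\Omega(\bar z)=\{\zeta:\limsup_{z\to\bar z,\,z\in\Omega}\langle\zeta,z-\bar z\rangle/\|z-\bar z\|\le0\}$; $N_\Omega(\bar z)$ is the set of limits $\lim\zeta_k$ with $\zeta_k\in\widehat N_\Omega(z_k)$, $z_k\in\Omega$, $z_k\to\bar z$; $D^*T(\bar x,\bar v)(w)=\{z:(z,-w)\in N_{\mathrm{gph}\,T}(\bar x,\bar v)\}$. *)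

theory Defs
  imports "HOL-Analysis.Analysis"
begin

text \<open>
  Extended-real-valued functions on a Euclidean space have type \<open>'a \<Rightarrow> ereal\<close>; set-valued
  mappings \<open>X \<rightrightarrows> Y\<close> have type \<open>'a \<Rightarrow> 'b set\<close>.  A neighborhood of a point is any set having
  the point in its interior.  The product \<open>X \<times> Y\<close> carries the library's Euclidean structure.
\<close>

definition gph :: "('a \<Rightarrow> 'b set) \<Rightarrow> ('a \<times> 'b) set" where
  "gph T = {(x, v). v \<in> T x}"

definition continuously_differentiable_around ::
    "('a::real_normed_vector \<Rightarrow> 'b::real_normed_vector) \<Rightarrow> 'a \<Rightarrow> bool" where
  "continuously_differentiable_around f xbar \<longleftrightarrow>
    (\<exists>U (f' :: 'a \<Rightarrow> 'a \<Rightarrow>\<^sub>L 'b). open U \<and> xbar \<in> U \<and>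
       (\<forall>x\<in>U. (f has_derivative blinfun_apply (f' x)) (at x)) \<and> continuous_on U f')"

text \<open>The filter \<open>at x\<close> is punctured, which is harmless for lower semicontinuity.\<close>

definition lower_semicontinuous :: "('a::topological_space \<Rightarrow> ereal) \<Rightarrow> bool" where
  "lower_semicontinuous g \<longleftrightarrow> (\<forall>x. g x \<le> Liminf (at x) g)"

subsection \<open>Subdifferentials\<close>

text \<open>Both subdifferentials are empty at points outside the effective domain of \<open>g\<close>.\<close>

definition frechet_subdifferential :: "('a::euclidean_space \<Rightarrow> ereal) \<Rightarrow> 'a \<Rightarrow> 'a set" where
  "frechet_subdifferential g xbar =
    {v. g xbar < \<infinity> \<and>
        0 \<le> Liminf (at xbar)
              (\<lambda>x. (g x - g xbar - ereal (v \<bullet> (x - xbar))) / ereal (norm (x - xbar)))}"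

definition limiting_subdifferential :: "('a::euclidean_space \<Rightarrow> ereal) \<Rightarrow> 'a \<Rightarrow> 'a set" where
  "limiting_subdifferential g xbar =
    {v. g xbar < \<infinity> \<and>
        (\<exists>(xs :: nat \<Rightarrow> 'a) (vs :: nat \<Rightarrow> 'a).
           (\<forall>k. vs k \<in> frechet_subdifferential g (xs k)) \<and>
           xs \<longlonglongrightarrow> xbar \<and> (\<lambda>k. g (xs k)) \<longlonglongrightarrow> g xbar \<and> vs \<longlonglongrightarrow> v)}"

definition prox_regular :: "('a::euclidean_space \<Rightarrow> ereal) \<Rightarrow> 'a \<Rightarrow> 'a \<Rightarrow> bool" where
  "prox_regular g xbar vhat \<longleftrightarrow>
    vhat \<in> limiting_subdifferential g xbar \<and>
    (\<exists>U V. \<exists>\<epsilon>>0. \<exists>r>0. xbar \<in> interior U \<and> vhat \<in> interior V \<and>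
       (\<forall>u\<in>U. \<forall>v \<in> limiting_subdifferential g u \<inter> V. g u \<le> g xbar + ereal \<epsilon> \<longrightarrow>
          (\<forall>x\<in>U. g x \<ge> g u + ereal (v \<bullet> (x - u) - r / 2 * (norm (x - u))\<^sup>2))))"

definition subdifferentially_continuous ::
    "('a::euclidean_space \<Rightarrow> ereal) \<Rightarrow> 'a \<Rightarrow> 'a \<Rightarrow> bool" where
  "subdifferentially_continuous g xbar vhat \<longleftrightarrow>
    vhat \<in> limiting_subdifferential g xbar \<and>
    continuous (at (xbar, vhat) within gph (limiting_subdifferential g)) (\<lambda>(x, v). g x)"

subsection \<open>Monotonicity\<close>

definition monotone_operator :: "('a::real_inner \<Rightarrow> 'a set) \<Rightarrow> bool" where
  "monotone_operator S \<longleftrightarrow>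
    (\<forall>(u1, v1) \<in> gph S. \<forall>(u2, v2) \<in> gph S. (v1 - v2) \<bullet> (u1 - u2) \<ge> 0)"

definition locally_strongly_maximally_monotone ::
    "('a::real_inner \<Rightarrow> 'a set) \<Rightarrow> 'a \<Rightarrow> 'a \<Rightarrow> bool" where
  "locally_strongly_maximally_monotone T xbar vbar \<longleftrightarrow>
    (\<exists>\<kappa>>0. \<exists>U V. xbar \<in> interior U \<and> vbar \<in> interior V \<and>
       (\<forall>(u1, v1) \<in> gph T \<inter> (U \<times> V). \<forall>(u2, v2) \<in> gph T \<inter> (U \<times> V).
          (v1 - v2) \<bullet> (u1 - u2) \<ge> \<kappa> * (norm (u1 - u2))\<^sup>2) \<and>
       (\<forall>S. monotone_operator S \<and> gph T \<inter> (U \<times> V) \<subseteq> gph S \<longrightarrow>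
          gph T \<inter> (U \<times> V) = gph S \<inter> (U \<times> V)))"

subsection \<open>Normal cones and the limiting coderivative\<close>

text \<open>At an isolated point of \<open>\<Omega>\<close> the upper limit is \<open>-\<infinity>\<close>, so every vector is a normal there.\<close>

definition frechet_normal_cone :: "'a::euclidean_space set \<Rightarrow> 'a \<Rightarrow> 'a set" where
  "frechet_normal_cone \<Omega> zbar =
    {\<zeta>. Limsup (at zbar within \<Omega>) (\<lambda>z. ereal (\<zeta> \<bullet> (z - zbar) / norm (z - zbar))) \<le> 0}"

definition limiting_normal_cone :: "'a::euclidean_space set \<Rightarrow> 'a \<Rightarrow> 'a set" where
  "limiting_normal_cone \<Omega> zbar =
    {\<zeta>. \<exists>(zs :: nat \<Rightarrow> 'a) (\<zeta>s :: nat \<Rightarrow> 'a).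
         (\<forall>k. zs k \<in> \<Omega> \<and> \<zeta>s k \<in> frechet_normal_cone \<Omega> (zs k)) \<and>
         zs \<longlonglongrightarrow> zbar \<and> \<zeta>s \<longlonglongrightarrow> \<zeta>}"

definition limiting_coderivative ::
    "('a::euclidean_space \<Rightarrow> 'b::euclidean_space set) \<Rightarrow> 'a \<Rightarrow> 'b \<Rightarrow> 'b \<Rightarrow> 'a set" where
  "limiting_coderivative T xbar vbar w =
    {z. (z, - w) \<in> limiting_normal_cone (gph T) (xbar, vbar)}"

definition positive_definite_mapping :: "('a::real_inner \<Rightarrow> 'a set) \<Rightarrow> bool" where
  "positive_definite_mapping D \<longleftrightarrow> (\<forall>w z. z \<in> D w \<and> w \<noteq> 0 \<longrightarrow> z \<bullet> w > 0)"

end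

theory Submission
  imports Defs
begin

text \<open>
  \<^bold>\<open>Idea of the proof.\<close>  Write \<open>D = f' xbar\<close> and let \<open>B = (D + D\<^sup>*) / 2 + \<sigma> I\<close> with \<open>\<sigma>\<close> large.
  Prox-regularity makes \<open>g + \<langle>B x, x\<rangle> / 2\<close> behave near \<open>xbar\<close> like a strongly convex function, as far
  as subgradients near \<open>vhat\<close> are concerned.  Minimizing \<open>g + \<langle>B x, x\<rangle> / 2 - \<langle>y, x\<rangle>\<close> over a small
  ball defines a Lipschitz map \<open>p\<close> near \<open>ybar = vhat + B xbar\<close> that charts the graph of the
  subdifferential: its points near \<open>(xbar, vhat)\<close> are exactly the pairs \<open>(p y, y - B (p y))\<close>
  (\<open>local_resolvent_exists\<close>).  Subdifferential continuity is what makes the function value bound in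
  prox-regularity automatic.  Moreover \<open>p\<close> is a subgradient selection of a convex function, the
  optimal value; this is the nonsmooth substitute for the symmetry of second derivatives.

  \<^bold>\<open>From positive definiteness to monotonicity.\<close>  Let \<open>l\<close> be the infimum of the Lipschitz constants
  of \<open>p\<close> on balls around \<open>ybar\<close>.  If \<open>p\<close> is \<open>L\<close>-Lipschitz, it is also cocoercive,
  \<open>|p y1 - p y2|\<^sup>2 \<le> L \<langle>p y1 - p y2, y1 - y2\<rangle>\<close>, because it has a convex potential
  (\<open>local_cocoercivity\<close>, a local Baillon-Haddad theorem).  So the strong monotonicity of \<open>T\<close> follows
  from \<open>l < 1 / \<sigma>\<close> (\<open>strongly_monotone_if_lipschitz\<close>).  If \<open>l > 0\<close>, a minimization argument at pairs
  of points which nearly attain \<open>l\<close> produces, in the limit, a unit vector \<open>q\<close> with \<open>(l q, -q)\<close> normal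
  to the graph of \<open>p\<close> (\<open>extremal_normal_sequence\<close>): as for a positive semidefinite matrix, the
  operator norm is an eigenvalue.  Translated to the graph of \<open>T\<close>, this is a coderivative pair
  \<open>(z, w)\<close> with \<open>w = - l q\<close> and \<open>\<langle>z, w\<rangle> = l (1 - \<sigma> l)\<close>.  Hence \<open>l < 1 / \<sigma>\<close>
  (\<open>lipschitz_modulus_if_positive_definite\<close>).  The skew part of \<open>D\<close> contributes nothing to
  \<open>\<langle>z, w\<rangle>\<close>, which is why only the symmetric part of \<open>D\<close> is put into \<open>B\<close>.

  \<^bold>\<open>Maximality and the converse.\<close>  If \<open>T\<close> is strongly monotone near \<open>(xbar, vbar)\<close>, the continuous
  map \<open>y \<mapsto> (y - B (p y)) + f (p y)\<close> is injective near \<open>ybar\<close>, hence open by invariance of domain, and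
  \<open>T\<close> has a Lipschitz single-valued inverse on a neighborhood of \<open>vbar\<close>
  (\<open>strongly_monotone_inverse_exists\<close>).  Such an inverse gives local maximality by Minty's
  argument.  It also gives \<open>\<langle>z, a\<rangle> \<ge> \<kappa> |a|\<^sup>2\<close> for every Frechet normal \<open>(z, -a)\<close>, by testing the normal
  in one well-chosen direction (\<open>frechet_normal_estimate\<close>); this estimate passes to limits.
\<close>

section \<open>Frechet normals, Frechet subgradients and lower semicontinuity\<close>

lemma frechet_normal_cone_iff:
  "\<zeta> \<in> frechet_normal_cone \<Omega> z \<longleftrightarrow>
    (\<forall>e>0. \<exists>d>0. \<forall>z'\<in>\<Omega>. dist z' z < d \<longrightarrow> \<zeta> \<bullet> (z' - z) \<le> e * norm (z' - z))"
  (is "_ \<longleftrightarrow> (\<forall>e>0. ?P e)")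
proof -
  let ?X = "\<lambda>z'. \<zeta> \<bullet> (z' - z) / norm (z' - z)"
  have ev: "(\<forall>\<^sub>F z' in at z within \<Omega>. ?X z' \<le> e) \<longleftrightarrow> ?P e" for e
  proof -
    have "(z' \<noteq> z \<and> dist z' z < d \<longrightarrow> ?X z' \<le> e) \<longleftrightarrow>
        (dist z' z < d \<longrightarrow> \<zeta> \<bullet> (z' - z) \<le> e * norm (z' - z))" for z' d
      by (cases "z' = z") (auto simp: pos_divide_le_eq)
    then show ?thesis
      unfolding eventually_at by (metis (no_types, lifting))
  qed
  have "\<zeta> \<in> frechet_normal_cone \<Omega> z \<longleftrightarrow>
      (\<forall>y>0. \<forall>\<^sub>F z' in at z within \<Omega>. ereal (?X z') < y)"
    unfolding frechet_normal_cone_def by (simp add: Limsup_le_iff)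
  also have "\<dots> \<longleftrightarrow> (\<forall>e>0. \<forall>\<^sub>F z' in at z within \<Omega>. ?X z' \<le> e)"
  proof safe
    fix e :: real assume *: "\<forall>y>0. \<forall>\<^sub>F z' in at z within \<Omega>. ereal (?X z') < y" "0 < e"
    then have "\<forall>\<^sub>F z' in at z within \<Omega>. ereal (?X z') < ereal e"
      using *(1)[rule_format, of "ereal e"] by (simp only: ereal_less(2))
    then show "\<forall>\<^sub>F z' in at z within \<Omega>. ?X z' \<le> e" by eventually_elim simp
  next
    fix y :: ereal assume *: "\<forall>e>0. \<forall>\<^sub>F z' in at z within \<Omega>. ?X z' \<le> e" "0 < y"
    obtain e where e: "0 < ereal e" "ereal e < y" using *(2) ereal_dense2 by blast
    then have "\<forall>\<^sub>F z' in at z within \<Omega>. ?X z' \<le> e" using *(1) by simp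
    then show "\<forall>\<^sub>F z' in at z within \<Omega>. ereal (?X z') < y"
      by eventually_elim (meson e(2) ereal_less_eq(3) le_less_trans)
  qed
  finally show ?thesis using ev by simp
qed

text \<open>
  A quadratic minorant at \<open>u\<close> suffices: the quadratic error is negligible against \<open>norm (x - u)\<close>.
\<close>

lemma frechet_subgradientI:
  assumes "g u \<noteq> \<infinity>" "g u \<noteq> - \<infinity>" "d > 0"
    and ge: "\<And>x. dist x u < d \<Longrightarrow> g x \<ge> g u + ereal (v \<bullet> (x - u) - C * (norm (x - u))\<^sup>2)"
  shows "v \<in> frechet_subdifferential g u"
proof -
  obtain a where a: "g u = ereal a" using assms by (cases "g u") auto
  have "\<forall>\<^sub>F x in at u. y < (g x - g u - ereal (v \<bullet> (x - u))) / ereal (norm (x - u))"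
    if y: "y < 0" for y
  proof -
    obtain e where e: "y < ereal e" "ereal e < 0" using y ereal_dense2 by blast
    define d' where "d' = min d (- e / (\<bar>C\<bar> + 1))"
    have d': "d' > 0" using e assms by (auto simp: d'_def divide_neg_pos)
    have "y < (g x - g u - ereal (v \<bullet> (x - u))) / ereal (norm (x - u))"
      if x: "x \<noteq> u" "dist x u < d'" for x
    proof -
      have n: "norm (x - u) > 0" using x by simp
      have "norm (x-u) < - e / (\<bar>C\<bar> + 1)" using x(2) by (simp add: d'_def dist_norm)
      then have *: "\<bar>C\<bar> * norm (x-u) \<le> - e"
        using n by (simp add: field_simps, linarith)
      have g: "g x \<ge> g u + ereal (v \<bullet> (x - u) - C * (norm (x - u))\<^sup>2)"
        using ge x(2) by (simp add: d'_def)
      show ?thesis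
      proof (cases "g x")
        case (real b)
        have "e \<le> - \<bar>C\<bar> * norm (x-u)" using * by simp
        also have "\<dots> \<le> - C * norm (x-u)" using n by simp
        also have "\<dots> = (- C * (norm (x - u))\<^sup>2) / norm (x-u)" by (simp add: power2_eq_square)
        also have "\<dots> \<le> (b - a - v \<bullet> (x-u)) / norm (x-u)"
          using g by (intro divide_right_mono) (auto simp: real a)
        finally show ?thesis using e real a n
          by (simp add: le_less_trans[OF _ e(1)] less_le_trans[OF e(1)])
      next
        case PInf
        then show ?thesis using y a n by auto
      next
        case MInf
        then show ?thesis using g a by simp
      qed
    qed
    then show ?thesis unfolding eventually_at using d' by auto
  qed
  then show ?thesis
    using assms(1) unfolding frechet_subdifferential_def by (auto simp: le_Liminf_iff less_top)
qed

lemma frechet_subset_limiting: "frechet_subdifferential g u \<subseteq> limiting_subdifferential g u"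
proof
  fix v assume v: "v \<in> frechet_subdifferential g u"
  show "v \<in> limiting_subdifferential g u"
    unfolding limiting_subdifferential_def
    using v
    by (intro CollectI conjI exI[of _ "\<lambda>_. u"] exI[of _ "\<lambda>_. v"])
       (auto simp: frechet_subdifferential_def)
qed

lemma lower_semicontinuous_nhds:
  assumes "lower_semicontinuous g" "c < g x"
  shows "\<exists>S. open S \<and> x \<in> S \<and> (\<forall>x'\<in>S. c < g x')"
proof -
  have "g x \<le> Liminf (at x) g" using assms by (simp add: lower_semicontinuous_def)
  then have "\<forall>\<^sub>F x' in at x. c < g x'" using assms(2) by (simp add: le_Liminf_iff)
  then obtain S where S: "open S" "x \<in> S" "\<And>x'. x' \<in> S \<Longrightarrow> x' \<noteq> x \<Longrightarrow> c < g x'"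
    unfolding eventually_at_topological by blast
  then show ?thesis using assms(2) by (intro exI[of _ S]) blast
qed

text \<open>
  If no point were minimal, each \<open>x\<close> would have a better point \<open>m x\<close>, and lower semicontinuity would
  keep \<open>F\<close> above \<open>F (m x)\<close> near \<open>x\<close>.  In a finite subcover, the best of the finitely many points
  \<open>m x\<close> contradicts this.
\<close>

lemma compact_attains_min_lsc:
  fixes F :: "'a::topological_space \<Rightarrow> 'b::linorder"
  assumes K: "compact K" "K \<noteq> {}"
    and lsc: "\<And>x c. x \<in> K \<Longrightarrow> c < F x \<Longrightarrow> \<exists>S. open S \<and> x \<in> S \<and> (\<forall>x'\<in>S \<inter> K. c < F x')"
  shows "\<exists>x\<in>K. \<forall>x'\<in>K. F x \<le> F x'"
proof (rule ccontr)
  assume "\<not> ?thesis"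
  then have "\<forall>x\<in>K. \<exists>x'\<in>K. F x' < F x" by (meson not_le)
  then obtain m where m: "\<And>x. x \<in> K \<Longrightarrow> m x \<in> K \<and> F (m x) < F x" by metis
  then have "\<forall>x\<in>K. \<exists>S. open S \<and> x \<in> S \<and> (\<forall>x'\<in>S \<inter> K. F (m x) < F x')"
    using lsc by blast
  then obtain S where S: "\<And>x. x \<in> K \<Longrightarrow> open (S x) \<and> x \<in> S x \<and> (\<forall>x'\<in>S x \<inter> K. F (m x) < F x')"
    by metis
  have "K \<subseteq> (\<Union>x\<in>K. S x)" using S by blast
  then obtain I where I: "I \<subseteq> K" "finite I" "K \<subseteq> (\<Union>x\<in>I. S x)"
    using compactE_image[OF K(1), of K S] S by metis
  have "I \<noteq> {}" using I K(2) by auto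
  then obtain i where i: "i \<in> I" "\<And>j. j \<in> I \<Longrightarrow> F (m i) \<le> F (m j)"
    using ex_min_if_finite[of "(\<lambda>i. F (m i)) ` I"] I(2) by (auto simp: not_less)
  then obtain j where j: "j \<in> I" "m i \<in> S j" using m I by blast
  then have "F (m j) < F (m i)" using S i m I(1) by blast
  then show False using i(2)[OF j(1)] by simp
qed

section \<open>Cocoercivity of Lipschitz subgradient selections\<close>

lemma square_le_cauchy:
  fixes h d :: "'a::real_inner"
  assumes "(norm h)\<^sup>2 \<le> d \<bullet> h"
  shows "norm h \<le> norm d"
proof (cases "h = 0")
  case False
  have "norm h * norm h \<le> norm d * norm h"
    using assms norm_cauchy_schwarz[of d h] by (simp add: power2_eq_square)
  then show ?thesis using False by simp
qed simp

text \<open>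
  The Baillon-Haddad theorem on a ball.  The Lipschitz bound gives the descent inequality
  \<open>m z \<le> m y + \<langle>p y, z - y\<rangle> + L / 2 |z - y|\<^sup>2\<close>.  Comparing it at \<open>y2\<close> with the subgradient inequality at
  \<open>y1\<close>, both evaluated at the gradient step \<open>z = y2 - (p y2 - p y1) / L\<close>, and adding the result with
  the roles of \<open>y1\<close> and \<open>y2\<close> exchanged yields the claim.  The step from \<open>y2\<close> has length at most
  \<open>|y1 - y2| < 2 \<rho>\<close>, which is why the hypotheses are needed on a ball of three times the radius.
\<close>

lemma local_cocoercivity:
  fixes p :: "'a::euclidean_space \<Rightarrow> 'a"
  assumes L: "0 < L" "L-lipschitz_on (ball c (3 * \<rho>)) p"
    and sub: "\<And>y z. y \<in> ball c (3 * \<rho>) \<Longrightarrow> z \<in> ball c (3 * \<rho>) \<Longrightarrow> m z \<ge> m y + p y \<bullet> (z - y)"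
    and y: "y1 \<in> ball c \<rho>" "y2 \<in> ball c \<rho>"
  shows "(norm (p y1 - p y2))\<^sup>2 \<le> L * ((p y1 - p y2) \<bullet> (y1 - y2))"
proof -
  let ?B = "ball c (3 * \<rho>)"
  have lip: "norm (p y - p z) \<le> L * norm (y - z)" if "y \<in> ?B" "z \<in> ?B" for y z
    using lipschitz_onD[OF L(2) that] by (simp add: dist_norm)
  have der: "(m has_derivative (\<lambda>h. p y \<bullet> h)) (at y)" if y: "y \<in> ?B" for y
    unfolding has_derivative_at_alt
  proof (intro conjI allI impI)
    show "bounded_linear (\<lambda>h. p y \<bullet> h)" by (rule bounded_linear_inner_right)
    fix e :: real assume e: "0 < e"
    obtain d where d: "d > 0" "ball y d \<subseteq> ?B" using y open_ball openE by blast
    show "\<exists>d>0. \<forall>z. norm (z - y) < d \<longrightarrow> norm (m z - m y - p y \<bullet> (z - y)) \<le> e * norm (z - y)"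
    proof (intro exI[of _ "min d (e / L)"] conjI allI impI)
      show "0 < min d (e / L)" using d e L by simp
      fix z assume z: "norm (z - y) < min d (e / L)"
      then have zB: "z \<in> ?B" using d by (auto simp: dist_norm norm_minus_commute)
      have 1: "m z \<ge> m y + p y \<bullet> (z - y)" using sub y zB by blast
      have "m y \<ge> m z + p z \<bullet> (y - z)" using sub y zB by blast
      then have "m z - m y - p y \<bullet> (z - y) \<le> (p z - p y) \<bullet> (z - y)"
        by (simp add: inner_diff_left inner_diff_right)
      also have "\<dots> \<le> norm (p z - p y) * norm (z - y)" by (rule norm_cauchy_schwarz)
      also have "\<dots> \<le> (L * norm (z - y)) * norm (z - y)"
        by (intro mult_right_mono lip zB y) simp
      also have "\<dots> \<le> e * norm (z - y)"
        using z L by (intro mult_right_mono) (auto simp: field_simps)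
      finally show "norm (m z - m y - p y \<bullet> (z - y)) \<le> e * norm (z - y)" using 1 by simp
    qed
  qed
  have descent: "m z \<le> m y + p y \<bullet> (z - y) + L / 2 * (norm (z - y))\<^sup>2"
    if yz: "y \<in> ?B" "z \<in> ?B" for y z
  proof -
    let ?h = "z - y"
    let ?\<psi> = "\<lambda>t. m (y + t *\<^sub>R ?h) - t * (p y \<bullet> ?h) - L / 2 * t\<^sup>2 * (norm ?h)\<^sup>2"
    have inB: "y + t *\<^sub>R ?h \<in> ?B" if "0 \<le> t" "t \<le> 1" for t
    proof -
      have "(1 - t) *\<^sub>R y + t *\<^sub>R z \<in> ?B"
        by (rule convexD_alt[OF convex_ball yz that])
      then show ?thesis by (simp add: algebra_simps)
    qed
    have "?\<psi> 1 \<le> ?\<psi> 0"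
    proof (rule DERIV_nonpos_imp_nonincreasing[where f = ?\<psi>])
      fix t :: real assume t: "0 \<le> t" "t \<le> 1"
      have "((\<lambda>t. m (y + t *\<^sub>R ?h)) has_derivative (\<lambda>s. p (y + t *\<^sub>R ?h) \<bullet> (s *\<^sub>R ?h))) (at t)"
        by (rule has_derivative_compose[where f = "\<lambda>t. y + t *\<^sub>R ?h" and g = m,
              OF _ der[OF inB[OF t]]]) (auto intro!: derivative_eq_intros)
      then have "((\<lambda>t. m (y + t *\<^sub>R ?h)) has_real_derivative (p (y + t *\<^sub>R ?h) \<bullet> ?h)) (at t)"
        by (simp add: has_field_derivative_def mult_commute_abs)
      then have D: "(?\<psi> has_real_derivative
          (p (y + t *\<^sub>R ?h) \<bullet> ?h - p y \<bullet> ?h - L / 2 * (2 * t) * (norm ?h)\<^sup>2)) (at t)"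
        by (auto intro!: derivative_eq_intros)
      have "(p (y + t *\<^sub>R ?h) - p y) \<bullet> ?h \<le> norm (p (y + t *\<^sub>R ?h) - p y) * norm ?h"
        by (rule norm_cauchy_schwarz)
      also have "\<dots> \<le> (L * norm (y + t *\<^sub>R ?h - y)) * norm ?h"
        by (intro mult_right_mono lip inB t yz) simp
      also have "\<dots> = L * t * (norm ?h)\<^sup>2" using t by (simp add: power2_eq_square)
      finally have "p (y + t *\<^sub>R ?h) \<bullet> ?h - p y \<bullet> ?h - L / 2 * (2 * t) * (norm ?h)\<^sup>2 \<le> 0"
        by (simp add: inner_diff_left)
      with D show "\<exists>D. (?\<psi> has_real_derivative D) (at t) \<and> D \<le> 0" by blast
    qed simp
    then show ?thesis by simp
  qed
  have half: "m y2 - m y1 - p y1 \<bullet> (y2 - y1) \<ge> (norm (p y1 - p y2))\<^sup>2 / (2 * L)"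
    if y: "y1 \<in> ball c \<rho>" "y2 \<in> ball c \<rho>" for y1 y2
  proof -
    have \<rho>: "\<rho> > 0" using y(1) by (simp add: le_less_trans[OF zero_le_dist])
    have yB: "y1 \<in> ?B" "y2 \<in> ?B" using y \<rho> by auto
    define z where "z = y2 - (1 / L) *\<^sub>R (p y2 - p y1)"
    have "norm (z - y2) = norm (p y2 - p y1) / L" using L by (simp add: z_def)
    also have "\<dots> \<le> norm (y2 - y1)" using lip[OF yB(2,1)] L by (simp add: field_simps)
    also have "\<dots> < 2 * \<rho>" using y dist_triangle_less_add[of y2 c \<rho> y1 \<rho>]
      by (simp add: dist_norm norm_minus_commute)
    finally have "dist z y2 < 2 * \<rho>" by (simp add: dist_norm)
    then have zB: "z \<in> ?B" using y dist_triangle[of c z y2] by (simp add: dist_commute)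
    have "m y1 + p y1 \<bullet> (z - y1) \<le> m z" using sub yB zB by blast
    also have "\<dots> \<le> m y2 + p y2 \<bullet> (z - y2) + L / 2 * (norm (z - y2))\<^sup>2"
      using descent yB zB by blast
    finally have "m y2 - m y1 - p y1 \<bullet> (y2 - y1)
        \<ge> - ((p y2 - p y1) \<bullet> (z - y2)) - L / 2 * (norm (z - y2))\<^sup>2"
      by (simp add: inner_diff_left inner_diff_right)
    also have "- ((p y2 - p y1) \<bullet> (z - y2)) - L / 2 * (norm (z - y2))\<^sup>2
        = (norm (p y1 - p y2))\<^sup>2 / (2 * L)"
    proof -
      have z: "z - y2 = - ((1 / L) *\<^sub>R (p y2 - p y1))" by (simp add: z_def)
      have "(p y2 - p y1) \<bullet> (z - y2) = - (norm (p y2 - p y1))\<^sup>2 / L"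
        unfolding z inner_minus_right inner_scaleR_right power2_norm_eq_inner by simp
      moreover have "(norm (z - y2))\<^sup>2 = (norm (p y2 - p y1))\<^sup>2 / L\<^sup>2"
        unfolding z norm_minus_cancel norm_scaleR using L by (simp add: power_divide)
      moreover have "norm (p y1 - p y2) = norm (p y2 - p y1)" by (rule norm_minus_commute)
      moreover have "L / 2 * (a / L\<^sup>2) = a / L / 2" "a / (2 * L) = a / L / 2" for a
        using L by (simp_all add: power2_eq_square)
      ultimately show ?thesis by simp
    qed
    finally show ?thesis by simp
  qed
  have "(norm (p y1 - p y2))\<^sup>2 / (2 * L) + (norm (p y1 - p y2))\<^sup>2 / (2 * L)
      \<le> (p y1 - p y2) \<bullet> (y1 - y2)"
    using half[OF y] half[OF y(2,1)] unfolding norm_minus_commute[of "p y2" "p y1"]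
    by (simp add: inner_diff_left inner_diff_right)
  then have "(norm (p y1 - p y2))\<^sup>2 / L \<le> (p y1 - p y2) \<bullet> (y1 - y2)" by simp
  then show ?thesis using L by (simp add: pos_divide_le_eq mult.commute)
qed

section \<open>Normals that realize the Lipschitz modulus\<close>

text \<open>
  The limit case of \<open>near_extremal_subgradient\<close>, where the two constants \<open>a\<close> and \<open>L\<close> there
  coincide with \<open>l\<close>.  The inequalities are then tight: they force \<open>|D| = 1\<close>, then \<open>H = l q\<close>, and
  then \<open>D = q\<close>.
\<close>

lemma extremal_direction_unique:
  fixes q D H :: "'a::real_inner"
  assumes l: "l > 0" and q: "norm q = 1"
    and 1: "q \<bullet> H \<ge> l / 2 + l / 2 * (norm D)\<^sup>2"
    and 2: "norm H \<le> l * norm D" and 3: "(norm H)\<^sup>2 \<le> l * (H \<bullet> D)"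
  shows "D = q"
proof -
  have "q \<bullet> H \<le> norm q * norm H" by (rule norm_cauchy_schwarz)
  then have "l / 2 + l / 2 * (norm D)\<^sup>2 \<le> l * norm D" using 1 2 q by simp
  then have "l * (norm D - 1)\<^sup>2 \<le> 0"
    by (simp add: power2_eq_square algebra_simps)
  then have "(norm D - 1)\<^sup>2 \<le> 0" using l by (simp add: mult_le_0_iff)
  then have D: "norm D = 1" by simp
  then have H: "norm H \<le> l" "q \<bullet> H \<ge> l" using 1 2 by auto
  then have nH: "norm H = l" using q norm_cauchy_schwarz[of q H] by simp
  have "(norm (H - l *\<^sub>R q))\<^sup>2 = (norm H)\<^sup>2 - 2 * l * (q \<bullet> H) + l\<^sup>2 * (norm q)\<^sup>2"
    unfolding power2_norm_eq_inner
    by (simp add: inner_diff_left inner_diff_right inner_commute power2_eq_square algebra_simps)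
  also have "\<dots> = 2 * l * (l - q \<bullet> H)" using nH q by (simp add: power2_eq_square algebra_simps)
  also have "\<dots> \<le> 0" using l H by (simp add: mult_le_0_iff)
  finally have Hq: "H = l *\<^sub>R q" by simp
  have "l\<^sup>2 \<le> l * (l * (q \<bullet> D))" using 3 nH by (simp add: Hq q)
  then have qD: "1 \<le> q \<bullet> D" using l by (simp add: power2_eq_square)
  have "(norm (D - q))\<^sup>2 = (norm D)\<^sup>2 - 2 * (q \<bullet> D) + (norm q)\<^sup>2"
    unfolding power2_norm_eq_inner by (simp add: inner_diff_left inner_diff_right inner_commute)
  also have "\<dots> \<le> 0" using D q qD by simp
  finally show ?thesis by simp
qed

text \<open>
  Let \<open>t = |y1 - y2|\<close>, let \<open>q\<close> be the direction of \<open>p y1 - p y2\<close>, and minimize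
  \<open>\<langle>q, p y\<rangle> + l / (2 t) |y - y1|\<^sup>2\<close>.  The penalty is calibrated so that, for \<open>a\<close> and \<open>L\<close> close to \<open>l\<close>,
  the point \<open>y2\<close> is nearly optimal; a minimizer \<open>y\<close> therefore satisfies almost the same relations
  as \<open>y2\<close>, and in addition the optimality condition says that \<open>l D\<close> with \<open>D = (y1 - y) / t\<close> is a
  subgradient of \<open>\<langle>q, p\<rangle>\<close> at \<open>y\<close>.  With \<open>H = (p y1 - p y) / t\<close>, the last three relations say that
  \<open>y\<close> is at least as good as \<open>y2\<close>, that \<open>p\<close> is Lipschitz and that \<open>p\<close> is cocoercive.
\<close>

lemma near_extremal_subgradient:
  fixes p :: "'a::euclidean_space \<Rightarrow> 'a"
  assumes l: "0 < l" "l / 2 \<le> a" "L \<le> 3 / 2 * l" "0 < L"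
    and lip: "L-lipschitz_on (ball c (27 * \<rho>)) p"
    and sub: "\<And>y z. y \<in> ball c (27 * \<rho>) \<Longrightarrow> z \<in> ball c (27 * \<rho>) \<Longrightarrow> m z \<ge> m y + p y \<bullet> (z - y)"
    and y: "y1 \<in> ball c \<rho>" "y2 \<in> ball c \<rho>" "y1 \<noteq> y2"
    and a: "norm (p y1 - p y2) \<ge> a * norm (y1 - y2)"
  shows "\<exists>y q D H C d. y \<in> ball c (9 * \<rho>) \<and> norm q = 1 \<and> norm D \<le> 3 \<and> d > 0 \<and>
      (\<forall>y'. dist y' y < d \<longrightarrow> q \<bullet> (p y' - p y) \<ge> l * (D \<bullet> (y' - y)) - C * (norm (y' - y))\<^sup>2) \<and>
      q \<bullet> H \<ge> a - l / 2 + l / 2 * (norm D)\<^sup>2 \<and> norm H \<le> L * norm D \<and>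
      (norm H)\<^sup>2 \<le> L * (H \<bullet> D)"
proof -
  have \<rho>: "\<rho> > 0" using y(1) by (simp add: le_less_trans[OF zero_le_dist])
  define t where "t = norm (y1 - y2)"
  have t: "t > 0" "t < 2 * \<rho>" using y dist_triangle_less_add[of y1 c \<rho> y2 \<rho>]
    by (auto simp: t_def dist_norm norm_minus_commute)
  have h: "norm (p y1 - p y2) > 0" using a l t(1) mult_pos_pos[of a t] unfolding t_def by linarith
  define q where "q = (1 / norm (p y1 - p y2)) *\<^sub>R (p y1 - p y2)"
  have q: "norm q = 1" using h by (simp add: q_def)
  have qh: "q \<bullet> (p y1 - p y2) \<ge> a * t"
  proof -
    have "q \<bullet> (p y1 - p y2) = norm (p y1 - p y2)"
      using h unfolding q_def inner_scaleR_left power2_norm_eq_inner[symmetric]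
      by (simp add: power2_eq_square)
    then show ?thesis using a by (simp add: t_def)
  qed
  let ?K = "cball y1 (4 * t)"
  have KB: "?K \<subseteq> ball c (9 * \<rho>)"
  proof
    fix z assume "z \<in> ?K"
    then show "z \<in> ball c (9 * \<rho>)"
      using t y(1) dist_triangle[of c z y1] by (simp add: dist_commute)
  qed
  have BB: "ball c (9 * \<rho>) \<subseteq> ball c (27 * \<rho>)" using \<rho> by (intro subset_ball) simp
  have y1B: "y1 \<in> ball c (9 * \<rho>)" using y \<rho> by auto
  let ?F = "\<lambda>y. q \<bullet> p y + l / (2 * t) * (norm (y - y1))\<^sup>2"
  have "continuous_on ?K p"
    by (rule continuous_on_subset[OF lipschitz_on_continuous_on[OF lip] order_trans[OF KB BB]])
  then have "continuous_on ?K ?F" by (intro continuous_intros)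
  then obtain y where yK: "y \<in> ?K" and min: "\<And>z. z \<in> ?K \<Longrightarrow> ?F y \<le> ?F z"
    using continuous_attains_inf[of ?K ?F] t by auto
  have yB: "y \<in> ball c (9 * \<rho>)" using yK KB by blast
  define D where "D = (1 / t) *\<^sub>R (y1 - y)"
  define H where "H = (1 / t) *\<^sub>R (p y1 - p y)"
  have HD: "y1 - y = t *\<^sub>R D" "p y1 - p y = t *\<^sub>R H" using t by (auto simp: D_def H_def)
  have qH: "q \<bullet> H \<ge> a - l / 2 + l / 2 * (norm D)\<^sup>2"
  proof -
    have "?F y \<le> ?F y2" using t by (intro min) (auto simp: t_def dist_norm)
    moreover have "norm (y - y1) = t * norm D" 
      unfolding norm_minus_commute[of y y1] HD(1) using t by simp
    moreover have "norm (y2 - y1) = t" by (simp add: t_def norm_minus_commute)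
    ultimately have "q \<bullet> p y + l / (2 * t) * (t * norm D)\<^sup>2 \<le> q \<bullet> p y2 + l / (2 * t) * t\<^sup>2" by simp
    then have "q \<bullet> (p y1 - p y) \<ge> q \<bullet> (p y1 - p y2) - t * (l / 2) + t * (l / 2 * (norm D)\<^sup>2)"
      using t by (simp add: inner_diff_right power2_eq_square algebra_simps)
    then have "t * (q \<bullet> H) \<ge> t * (a - l / 2 + l / 2 * (norm D)\<^sup>2)"
      using qh by (simp add: HD algebra_simps)
    then show ?thesis using t by simp
  qed
  have "norm (p y1 - p y) \<le> L * norm (y1 - y)"
    using lipschitz_onD[OF lip subsetD[OF BB y1B] subsetD[OF BB yB]] by (simp add: dist_norm)
  then have HLD: "norm H \<le> L * norm D" using t by (simp add: HD)
  have coco: "(norm H)\<^sup>2 \<le> L * (H \<bullet> D)"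
  proof -
    have "(norm (p y1 - p y))\<^sup>2 \<le> L * ((p y1 - p y) \<bullet> (y1 - y))"
      by (rule local_cocoercivity[of L c "9 * \<rho>" p m]) (use lip sub l yB y1B in auto)
    then have "t\<^sup>2 * (norm H)\<^sup>2 \<le> t\<^sup>2 * (L * (H \<bullet> D))"
      unfolding HD inner_scaleR_left inner_scaleR_right norm_scaleR power_mult_distrib power2_abs
      by (simp add: power2_eq_square mult.assoc mult.left_commute)
    then show ?thesis using t by simp
  qed
  \<comment> \<open>This puts the minimizer in the interior of \<open>?K\<close>, whose radius is \<open>4 * t\<close>.\<close>
  have nD: "norm D \<le> 3"
  proof -
    have "q \<bullet> H \<le> norm H" using norm_cauchy_schwarz[of q H] q by simp
    then have "l / 2 * (norm D)\<^sup>2 \<le> L * norm D" using qH HLD l by linarith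
    also have "\<dots> \<le> 3 / 2 * l * norm D" using l by (intro mult_right_mono) auto
    finally have "(l * norm D) * norm D \<le> (l * norm D) * 3" by (simp add: power2_eq_square)
    then show ?thesis using l by (cases "D = 0") auto
  qed
  have "dist y1 y < 4 * t" using nD t by (simp add: dist_norm HD) 
  then obtain d where d: "d > 0" "ball y d \<subseteq> ?K"
    using open_ball[of y1 "4 * t"] unfolding open_contains_ball
    by (meson ball_subset_cball mem_ball order_trans)
  have "q \<bullet> (p y' - p y) \<ge> l * (D \<bullet> (y' - y)) - l / (2 * t) * (norm (y' - y))\<^sup>2"
    if "dist y' y < d" for y'
  proof -
    have "?F y \<le> ?F y'" using d that by (intro min subsetD[OF d(2)]) (simp add: dist_commute)
    moreover have "(norm (y' - y1))\<^sup>2 = (norm (y' - y))\<^sup>2 + (norm (y - y1))\<^sup>2 - 2 * t * (D \<bullet> (y' - y))"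
    proof -
      have "y' - y1 = (y' - y) - t *\<^sub>R D" "y - y1 = - t *\<^sub>R D" using HD by (simp_all add: algebra_simps)
      then have "(norm (y' - y1))\<^sup>2 = (norm (y' - y))\<^sup>2 + (norm (t *\<^sub>R D))\<^sup>2 - 2 * ((y' - y) \<bullet> (t *\<^sub>R D))"
        "norm (y - y1) = norm (t *\<^sub>R D)"
        by (simp_all only: power2_norm_eq_inner norm_minus_cancel scaleR_minus_left)
           (simp add: inner_diff inner_commute)
      then show ?thesis by (simp add: inner_commute)
    qed
    ultimately show ?thesis using t by (simp add: inner_diff_right algebra_simps)
  qed
  then show ?thesis using yB q nD d qH HLD coco by blast
qed

text \<open>
  The vectors \<open>l Ds k\<close> are Frechet subgradients of \<open>\<langle>q k, p\<rangle>\<close> at \<open>y k\<close>, so \<open>(l Ds k, - q k)\<close> is a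
  Frechet normal to the graph of \<open>p\<close>; in the limit this becomes \<open>(l q0, - q0)\<close>.  The sequences \<open>Ds\<close>
  and \<open>q\<close> have the same limit by compactness and \<open>extremal_direction_unique\<close>, applied to pairs of points whose
  difference quotients approach the modulus \<open>l\<close>.
\<close>

lemma extremal_normal_sequence:
  fixes p :: "'a::euclidean_space \<Rightarrow> 'a"
  assumes l: "0 < l"
    and upper: "\<And>L. L > l \<Longrightarrow> \<exists>\<rho>>0. L-lipschitz_on (ball c \<rho>) p"
    and lower: "\<And>L \<rho>. 0 \<le> L \<Longrightarrow> L < l \<Longrightarrow> \<rho> > 0 \<Longrightarrow> \<not> L-lipschitz_on (ball c \<rho>) p"
    and sub: "\<And>y z. y \<in> ball c \<rho>0 \<Longrightarrow> z \<in> ball c \<rho>0 \<Longrightarrow> m z \<ge> m y + p y \<bullet> (z - y)" "\<rho>0 > 0"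
  shows "\<exists>y q Ds q0. y \<longlonglongrightarrow> c \<and> q \<longlonglongrightarrow> q0 \<and> Ds \<longlonglongrightarrow> q0 \<and> norm q0 = 1 \<and>
    (\<forall>k::nat. dist c (y k) < \<rho>0 \<and> (\<exists>C. \<exists>d>0. \<forall>y'. dist y' (y k) < d \<longrightarrow>
       l * (Ds k \<bullet> (y' - y k)) \<le> q k \<bullet> (p y' - p (y k)) + C * (norm (y' - y k))\<^sup>2))"
proof -
  \<comment> \<open>The shift by 2 keeps \<open>\<eta> k \<le> l / 2\<close>, as \<open>near_extremal_subgradient\<close> requires.\<close>
  define \<eta> where "\<eta> k = l / real (k + 2)" for k
  have \<eta>: "0 < \<eta> k" "\<eta> k \<le> l / 2" for k using l by (auto simp: \<eta>_def field_simps)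
  have \<eta>0: "\<eta> \<longlonglongrightarrow> 0"
    using tendsto_mult_left[OF LIMSEQ_Suc[OF LIMSEQ_inverse_real_of_nat], of l]
    by (simp add: \<eta>_def[abs_def] divide_inverse add.commute)
  define P where "P k y q D H \<longleftrightarrow> y \<in> ball c (min \<rho>0 (\<eta> k)) \<and> norm q = 1 \<and> norm D \<le> 3 \<and>
      (\<exists>C. \<exists>d>0. \<forall>y'. dist y' y < d \<longrightarrow>
        l * (D \<bullet> (y' - y)) \<le> q \<bullet> (p y' - p y) + C * (norm (y' - y))\<^sup>2) \<and>
      q \<bullet> H \<ge> (l - \<eta> k) - l / 2 + l / 2 * (norm D)\<^sup>2 \<and> norm H \<le> (l + \<eta> k) * norm D \<and>
      (norm H)\<^sup>2 \<le> (l + \<eta> k) * (H \<bullet> D)" for k y q D H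
  have "\<exists>y q D H. P k y q D H" for k
  proof -
    obtain \<rho>1 where \<rho>1: "\<rho>1 > 0" "(l + \<eta> k)-lipschitz_on (ball c \<rho>1) p"
      using upper[of "l + \<eta> k"] \<eta>[of k] by auto
    define \<rho> where "\<rho> = min (\<eta> k) (min \<rho>0 \<rho>1) / 27"
    have \<rho>: "\<rho> > 0" "27 * \<rho> \<le> \<eta> k" "27 * \<rho> \<le> \<rho>0" "27 * \<rho> \<le> \<rho>1"
      using \<rho>1 \<eta> sub(2) by (auto simp: \<rho>_def)
    have "\<not> (l - \<eta> k)-lipschitz_on (ball c \<rho>) p"
      using lower[of "l - \<eta> k" \<rho>] \<eta>[of k] \<rho> l by auto
    then obtain y1 y2 where y: "y1 \<in> ball c \<rho>" "y2 \<in> ball c \<rho>"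
      "(l - \<eta> k) * dist y1 y2 < dist (p y1) (p y2)"
      using \<eta>[of k] l unfolding lipschitz_on_def by (auto simp: not_le)
    have "\<exists>y q D H C d. y \<in> ball c (9 * \<rho>) \<and> norm q = 1 \<and> norm D \<le> 3 \<and> d > 0 \<and>
      (\<forall>y'. dist y' y < d \<longrightarrow> q \<bullet> (p y' - p y) \<ge> l * (D \<bullet> (y' - y)) - C * (norm (y' - y))\<^sup>2) \<and>
      q \<bullet> H \<ge> (l - \<eta> k) - l / 2 + l / 2 * (norm D)\<^sup>2 \<and> norm H \<le> (l + \<eta> k) * norm D \<and>
      (norm H)\<^sup>2 \<le> (l + \<eta> k) * (H \<bullet> D)"
    proof (rule near_extremal_subgradient)
      show "(l + \<eta> k)-lipschitz_on (ball c (27 * \<rho>)) p"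
        using \<rho>1(2) by (rule lipschitz_on_subset) (use \<rho> in auto)
      show "m z \<ge> m y + p y \<bullet> (z - y)" if "y \<in> ball c (27 * \<rho>)" "z \<in> ball c (27 * \<rho>)" for y z
        using sub(1)[of y z] that \<rho> by auto
      show "y1 \<noteq> y2" using y by auto
      show "(l - \<eta> k) * norm (y1 - y2) \<le> norm (p y1 - p y2)" using y by (simp add: dist_norm)
    qed (use y \<eta>[of k] l in auto)
    then obtain y q D H C d where *: "y \<in> ball c (9 * \<rho>)" "norm q = 1" "norm D \<le> 3" "d > 0"
      "\<And>y'. dist y' y < d \<Longrightarrow> q \<bullet> (p y' - p y) \<ge> l * (D \<bullet> (y' - y)) - C * (norm (y' - y))\<^sup>2"
      "q \<bullet> H \<ge> (l - \<eta> k) - l / 2 + l / 2 * (norm D)\<^sup>2" "norm H \<le> (l + \<eta> k) * norm D"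
      "(norm H)\<^sup>2 \<le> (l + \<eta> k) * (H \<bullet> D)" by blast
    have "\<exists>C. \<exists>d>0. \<forall>y'. dist y' y < d \<longrightarrow>
        l * (D \<bullet> (y' - y)) \<le> q \<bullet> (p y' - p y) + C * (norm (y' - y))\<^sup>2"
      using *(4,5) by (intro exI[of _ C] exI[of _ d]) (auto simp: algebra_simps)
    moreover have "y \<in> ball c (min \<rho>0 (\<eta> k))" using *(1) \<rho> by auto
    ultimately have "P k y q D H" using *(2,3,6-8) unfolding P_def by (simp only: simp_thms)
    then show ?thesis by blast
  qed
  then have "\<forall>k. \<exists>y q D H. P k y q D H" by blast
  then have "\<exists>y q D H. \<forall>k. P k (y k) (q k) (D k) (H k)" by (simp only: choice_iff)
  then obtain y q D H where PP: "\<And>k. P k (y k) (q k) (D k) (H k)" by blast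
  have P: "dist c (y k) < \<rho>0" "dist c (y k) < \<eta> k" "norm (q k) = 1" "norm (D k) \<le> 3"
      "\<exists>C. \<exists>d>0. \<forall>y'. dist y' (y k) < d \<longrightarrow>
        l * (D k \<bullet> (y' - y k)) \<le> q k \<bullet> (p y' - p (y k)) + C * (norm (y' - y k))\<^sup>2"
      "(l - \<eta> k) - l / 2 + l / 2 * (norm (D k))\<^sup>2 \<le> q k \<bullet> H k"
      "norm (H k) \<le> (l + \<eta> k) * norm (D k)"
      "(norm (H k))\<^sup>2 \<le> (l + \<eta> k) * (H k \<bullet> D k)" for k
    using PP[of k] unfolding P_def by (simp_all only: mem_ball min_less_iff_conj simp_thms)
  have nH: "norm (H k) \<le> 2 * l * 3" for k
  proof -
    have "norm (H k) \<le> (l + \<eta> k) * norm (D k)" by (rule P)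
    also have "\<dots> \<le> 2 * l * 3" using P(4)[of k] \<eta>[of k] l by (intro mult_mono) auto
    finally show ?thesis .
  qed
  let ?K = "cball (0::'a) 1 \<times> cball (0::'a) 3 \<times> cball (0::'a) (2 * l * 3)"
  have "compact ?K" by (intro compact_Times compact_cball)
  then have "seq_compact ?K" by (simp only: compact_eq_seq_compact_metric)
  moreover have "\<And>k. (q k, D k, H k) \<in> ?K" using P(3,4) nH by simp
  ultimately obtain x r where r: "strict_mono r" "((\<lambda>k. (q k, D k, H k)) \<circ> r) \<longlonglongrightarrow> x"
    using seq_compactE[of ?K "\<lambda>k. (q k, D k, H k)"] by metis
  obtain q0 D0 H0 where x: "x = (q0, D0, H0)" by (cases x) auto
  have qr: "(\<lambda>k. q (r k)) \<longlonglongrightarrow> q0" and Dr: "(\<lambda>k. D (r k)) \<longlonglongrightarrow> D0" and Hr: "(\<lambda>k. H (r k)) \<longlonglongrightarrow> H0"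
    using tendsto_fst[OF r(2)] tendsto_fst[OF tendsto_snd[OF r(2)]] tendsto_snd[OF tendsto_snd[OF r(2)]]
    by (auto simp: x o_def)
  have \<eta>r: "(\<lambda>k. \<eta> (r k)) \<longlonglongrightarrow> 0"
    using LIMSEQ_subseq_LIMSEQ[OF \<eta>0 r(1)] by (simp add: o_def)
  have q0: "norm q0 = 1"
    using tendsto_norm[OF qr] P(3) by (simp add: LIMSEQ_const_iff)
  have "D0 = q0"
  proof (rule extremal_direction_unique[OF l q0])
    have "(\<lambda>k. (l - \<eta> (r k)) - l / 2 + l / 2 * (norm (D (r k)))\<^sup>2)
        \<longlonglongrightarrow> (l - 0) - l / 2 + l / 2 * (norm D0)\<^sup>2"
      by (intro tendsto_intros \<eta>r Dr)
    then have "(l - 0) - l / 2 + l / 2 * (norm D0)\<^sup>2 \<le> q0 \<bullet> H0"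
      by (rule LIMSEQ_le[OF _ tendsto_inner[OF qr Hr]]) (intro exI allI impI P(6))
    then show "q0 \<bullet> H0 \<ge> l / 2 + l / 2 * (norm D0)\<^sup>2" by simp
    have lD: "(\<lambda>k. (l + \<eta> (r k)) * norm (D (r k))) \<longlonglongrightarrow> (l + 0) * norm D0"
      by (intro tendsto_intros \<eta>r Dr)
    have "norm H0 \<le> (l + 0) * norm D0"
      by (rule LIMSEQ_le[OF tendsto_norm[OF Hr] lD]) (intro exI allI impI P(7))
    then show "norm H0 \<le> l * norm D0" by simp
    have lHD: "(\<lambda>k. (l + \<eta> (r k)) * (H (r k) \<bullet> D (r k))) \<longlonglongrightarrow> (l + 0) * (H0 \<bullet> D0)"
      by (intro tendsto_intros \<eta>r Dr Hr)
    have "(norm H0)\<^sup>2 \<le> (l + 0) * (H0 \<bullet> D0)"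
      by (rule LIMSEQ_le[OF tendsto_power[OF tendsto_norm[OF Hr]] lHD]) (intro exI allI impI P(8))
    then show "(norm H0)\<^sup>2 \<le> l * (H0 \<bullet> D0)" by simp
  qed
  then have Dq: "(\<lambda>k. D (r k)) \<longlonglongrightarrow> q0" using Dr by simp
  have yr: "(\<lambda>k. y (r k)) \<longlonglongrightarrow> c"
  proof (rule metric_LIMSEQ_I)
    fix e :: real assume "0 < e"
    then obtain N where N: "\<And>k. k \<ge> N \<Longrightarrow> \<bar>\<eta> (r k)\<bar> < e"
      using LIMSEQ_D[OF \<eta>r] by auto
    have "dist (y (r k)) c < e" if "k \<ge> N" for k
      using P(2)[of "r k"] N[OF that] by (simp add: dist_commute)
    then show "\<exists>N. \<forall>k\<ge>N. dist (y (r k)) c < e" by blast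
  qed
  have fin: "\<forall>k. dist c (y (r k)) < \<rho>0 \<and> (\<exists>C. \<exists>d>0. \<forall>y'. dist y' (y (r k)) < d \<longrightarrow>
       l * (D (r k) \<bullet> (y' - y (r k)))
         \<le> q (r k) \<bullet> (p y' - p (y (r k))) + C * (norm (y' - y (r k)))\<^sup>2)"
    by (rule allI, rule conjI, rule P(1), rule P(5))
  show ?thesis
    by (rule exI[of _ "\<lambda>k. y (r k)"], rule exI[of _ "\<lambda>k. q (r k)"], rule exI[of _ "\<lambda>k. D (r k)"],
        rule exI[of _ q0]) (rule conjI yr qr Dq q0 fin)+
qed

section \<open>The local resolvent of a prox-regular function\<close>

text \<open>
  Only the quadratic form of \<open>D\<close> matters for strong monotonicity, and a symmetric \<open>B\<close> is the
  derivative of a quadratic function, which can be added to \<open>g\<close>.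
\<close>

lemma symmetric_part_shift:
  fixes D :: "'a::euclidean_space \<Rightarrow> 'a"
  assumes D: "bounded_linear D"
  shows "\<exists>\<sigma>>0. \<exists>B. bounded_linear B \<and> (\<forall>x y. B x \<bullet> y = x \<bullet> B y) \<and>
    (\<forall>x. B x \<bullet> x = D x \<bullet> x + \<sigma> * (norm x)\<^sup>2) \<and> (\<forall>x. (r + 1) * (norm x)\<^sup>2 \<le> B x \<bullet> x)"
proof -
  obtain K where K: "K > 0" "\<And>x. norm (D x) \<le> norm x * K"
    using bounded_linear.pos_bounded[OF D] by blast
  define \<sigma> where "\<sigma> = K + \<bar>r\<bar> + 1"
  define B where "B x = (1 / 2) *\<^sub>R (D x + adjoint D x) + \<sigma> *\<^sub>R x" for x
  have lin: "linear D" using D by (rule bounded_linear.linear)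
  have adj: "adjoint D x \<bullet> y = x \<bullet> D y" "x \<bullet> adjoint D y = D x \<bullet> y" for x y
    by (auto simp: adjoint_clauses[OF lin])
  have "linear B"
    unfolding B_def using lin adjoint_linear[OF lin]
    by (intro linear_compose_add linear_compose_scale_right linear_ident) auto
  moreover have q: "B x \<bullet> x = D x \<bullet> x + \<sigma> * (norm x)\<^sup>2" for x
  proof -
    have "B x \<bullet> x = (1 / 2) * (D x \<bullet> x + x \<bullet> D x) + \<sigma> * (x \<bullet> x)"
      by (simp only: B_def inner_add_left inner_scaleR_left adj)
    then show ?thesis by (simp add: inner_commute power2_norm_eq_inner)
  qed
  moreover have "B x \<bullet> y = x \<bullet> B y" for x y
    unfolding B_def inner_add_left inner_add_right inner_scaleR_left inner_scaleR_right adj by simp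
  moreover have "(r + 1) * (norm x)\<^sup>2 \<le> B x \<bullet> x" for x
  proof -
    have "- (D x \<bullet> x) \<le> norm (D x) * norm x" using Cauchy_Schwarz_ineq2[of "D x" x] by linarith
    also have "\<dots> \<le> (norm x * K) * norm x" by (intro mult_right_mono K) simp
    also have "\<dots> = K * (norm x)\<^sup>2" by (simp add: power2_eq_square)
    finally have "\<sigma> * (norm x)\<^sup>2 - K * (norm x)\<^sup>2 \<le> B x \<bullet> x" using q by simp
    moreover have "(r + 1) * (norm x)\<^sup>2 \<le> (\<bar>r\<bar> + 1) * (norm x)\<^sup>2" by (intro mult_right_mono) auto
    ultimately show ?thesis unfolding \<sigma>_def by (simp add: distrib_right)
  qed
  moreover have "\<sigma> > 0" using K by (simp add: \<sigma>_def)
  ultimately show ?thesis by (intro exI[of _ \<sigma>] conjI exI[of _ B]) (auto simp: linear_conv_bounded_linear)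
qed

lemma dist_prod_le_sum: "dist (a, b) (c, d) \<le> dist a c + dist b d"
  unfolding dist_Pair_Pair by (rule sqrt_sum_squares_le_sum) simp_all

text \<open>
  Prox-regularity speaks about subgradients at points \<open>u\<close> with \<open>g u \<le> g xbar + \<epsilon>\<close>.  Subdifferential
  continuity gives this bound for all \<open>(u, v)\<close> in the graph that are close to \<open>(xbar, vhat)\<close>.
\<close>

lemma prox_regular_uniform_growth:
  fixes g :: "'a::euclidean_space \<Rightarrow> ereal"
  assumes ninf: "\<forall>x. g x \<noteq> - \<infinity>" and pr: "prox_regular g xbar vhat"
    and sc: "subdifferentially_continuous g xbar vhat"
  shows "\<exists>r>0. \<exists>\<rho>>0. \<forall>u\<in>cball xbar \<rho>. \<forall>v\<in>limiting_subdifferential g u. dist v vhat < \<rho> \<longrightarrow>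
    (\<forall>x\<in>cball xbar \<rho>. g x \<ge> g u + ereal (v \<bullet> (x - u) - r / 2 * (norm (x - u))\<^sup>2))"
proof -
  let ?G = "gph (limiting_subdifferential g)"
  obtain U V \<epsilon> r where er: "\<epsilon> > 0" "r > 0" and UV: "xbar \<in> interior U" "vhat \<in> interior V"
    and gr: "\<And>u v x. u \<in> U \<Longrightarrow> v \<in> limiting_subdifferential g u \<inter> V \<Longrightarrow> g u \<le> g xbar + ereal \<epsilon> \<Longrightarrow>
      x \<in> U \<Longrightarrow> g x \<ge> g u + ereal (v \<bullet> (x - u) - r / 2 * (norm (x - u))\<^sup>2)"
    using pr unfolding prox_regular_def by blast
  have "vhat \<in> limiting_subdifferential g xbar" using pr by (simp add: prox_regular_def)
  then have "g xbar < \<infinity>" by (simp add: limiting_subdifferential_def)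
  then obtain a where a: "g xbar = ereal a" using ninf by (cases "g xbar") auto
  have lim: "((\<lambda>(x, v). g x) \<longlongrightarrow> g xbar) (at (xbar, vhat) within ?G)"
    using sc by (simp add: subdifferentially_continuous_def continuous_within)
  have "g xbar < g xbar + ereal \<epsilon>" using a er by simp
  from order_tendstoD(2)[OF lim this]
  obtain d where d: "d > 0"
    "\<And>z. z \<in> ?G \<Longrightarrow> z \<noteq> (xbar, vhat) \<Longrightarrow> dist z (xbar, vhat) < d \<Longrightarrow> (case z of (x, v) \<Rightarrow> g x) < g xbar + ereal \<epsilon>"
    unfolding eventually_at by blast
  obtain e1 where e1: "e1 > 0" "cball xbar e1 \<subseteq> U" using UV(1) mem_interior_cball by blast
  obtain e2 where e2: "e2 > 0" "cball vhat e2 \<subseteq> V" using UV(2) mem_interior_cball by blast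
  define \<rho> where "\<rho> = min (min e1 e2) (d / 2)"
  have \<rho>: "\<rho> > 0" "\<rho> \<le> e1" "\<rho> \<le> e2" "\<rho> \<le> d / 2" using e1 e2 d by (auto simp: \<rho>_def)
  have "g x \<ge> g u + ereal (v \<bullet> (x - u) - r / 2 * (norm (x - u))\<^sup>2)"
    if u: "u \<in> cball xbar \<rho>" and v: "v \<in> limiting_subdifferential g u" "dist v vhat < \<rho>"
      and x: "x \<in> cball xbar \<rho>" for u v x
  proof (rule gr)
    show "u \<in> U" "x \<in> U" using u x e1 \<rho> by auto
    show "v \<in> limiting_subdifferential g u \<inter> V" using v e2 \<rho> by (auto simp: dist_commute)
    show "g u \<le> g xbar + ereal \<epsilon>"
    proof (cases "(u, v) = (xbar, vhat)")
      case True then show ?thesis using a er by simp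
    next
      case False
      have "dist (u, v) (xbar, vhat) < d"
        using dist_prod_le_sum[of u v xbar vhat] u v \<rho> by (simp add: dist_commute)
      then show ?thesis using d(2)[of "(u, v)"] False v by (simp add: gph_def)
    qed
  qed
  then show ?thesis using er \<rho> by blast
qed

lemma lsc_add_continuous:
  fixes g :: "'a::topological_space \<Rightarrow> ereal" and h :: "'a \<Rightarrow> real"
  assumes ninf: "\<forall>x. g x \<noteq> - \<infinity>" and lsc: "lower_semicontinuous g" and h: "continuous_on UNIV h"
    and c: "c < g x + ereal (h x)"
  shows "\<exists>S. open S \<and> x \<in> S \<and> (\<forall>x'\<in>S. c < g x' + ereal (h x'))"
proof (cases c)
  case (real c')
  have "ereal (c' - h x) < g x" using c real by (cases "g x") auto
  then obtain b where b: "ereal (c' - h x) < ereal b" "ereal b < g x" using ereal_dense2 by blast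
  obtain S where S: "open S" "x \<in> S" "\<And>x'. x' \<in> S \<Longrightarrow> ereal b < g x'"
    using lower_semicontinuous_nhds[OF lsc b(2)] by blast
  have "open {x'. c' - b < h x'}"
    using open_Collect_less[OF continuous_on_const h] by simp
  moreover have "c < g x' + ereal (h x')" if "x' \<in> S" "c' - b < h x'" for x'
    using S(3)[OF that(1)] that(2) real by (cases "g x'") auto
  ultimately show ?thesis using S b by (intro exI[of _ "S \<inter> {x'. c' - b < h x'}"]) auto
next
  case MInf
  have "c < g x' + ereal (h x')" for x' using ninf MInf by (cases "g x'") auto
  then show ?thesis by blast
qed (use c in auto)

text \<open>
  \<open>p\<close> is a local single-valued inverse of \<open>G + B\<close>, where \<open>G\<close> stands for the subdifferential: the graph
  of \<open>G\<close> near \<open>(xbar, vhat)\<close> consists of points \<open>(p y, y - B (p y))\<close>.  The function \<open>m\<close> is a convex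
  potential of \<open>p\<close>.
\<close>

locale local_resolvent =
  fixes G :: "'a::euclidean_space \<Rightarrow> 'a set" and B p :: "'a \<Rightarrow> 'a" and m :: "'a \<Rightarrow> real"
    and xbar vhat :: 'a and \<epsilon> \<delta> :: real
  assumes B: "bounded_linear B" and eps: "\<epsilon> > 0" and del: "\<delta> > 0"
    and p_center: "p (vhat + B xbar) = xbar"
    and p_mem: "\<And>y. y \<in> ball (vhat + B xbar) \<epsilon> \<Longrightarrow> y - B (p y) \<in> G (p y)"
    and p_lip: "1-lipschitz_on (ball (vhat + B xbar) \<epsilon>) p"
    and p_sub: "\<And>y z. y \<in> ball (vhat + B xbar) \<epsilon> \<Longrightarrow> z \<in> ball (vhat + B xbar) \<epsilon> \<Longrightarrow>
      m z \<ge> m y + p y \<bullet> (z - y)"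
    and p_inv: "\<And>u v. v \<in> G u \<Longrightarrow> dist u xbar < \<delta> \<Longrightarrow> dist v vhat < \<delta> \<Longrightarrow>
      v + B u \<in> ball (vhat + B xbar) \<epsilon> \<and> p (v + B u) = u"

text \<open>
  Let \<open>q x = \<langle>B x, x\<rangle> / 2\<close>.  The predicate \<open>good y u\<close> says that \<open>u\<close> minimizes \<open>g + q - \<langle>y, \<cdot>\<rangle>\<close> over the
  ball with quadratic growth.  Every subgradient \<open>v\<close> near \<open>vhat\<close> at a point \<open>u\<close> near \<open>xbar\<close> gives such a
  minimizer for \<open>y = v + B u\<close>, since \<open>B\<close> dominates \<open>r + 1\<close>.  Conversely, a minimizer for \<open>y\<close> near
  \<open>ybar\<close> lies in the interior of the ball, so \<open>y - B u\<close> is a subgradient there, close to \<open>vhat\<close>.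
  Quadratic growth makes the minimizer unique and nonexpansive in \<open>y\<close>.  The potential is
  \<open>m y = max\<^sub>x (\<langle>y, x\<rangle> - g x - q x)\<close>.
\<close>

lemma local_resolvent_exists:
  fixes g :: "'a::euclidean_space \<Rightarrow> ereal"
  assumes ninf: "\<forall>x. g x \<noteq> - \<infinity>" and lsc: "lower_semicontinuous g"
    and vhat: "vhat \<in> limiting_subdifferential g xbar" and \<rho>: "\<rho> > 0"
    and growth: "\<And>u v x. u \<in> cball xbar \<rho> \<Longrightarrow> v \<in> limiting_subdifferential g u \<Longrightarrow> dist v vhat < \<rho> \<Longrightarrow>
      x \<in> cball xbar \<rho> \<Longrightarrow> g x \<ge> g u + ereal (v \<bullet> (x - u) - r / 2 * (norm (x - u))\<^sup>2)"
    and B: "bounded_linear B" and sym: "\<And>x y. B x \<bullet> y = x \<bullet> B y"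
    and pos: "\<And>x. (r + 1) * (norm x)\<^sup>2 \<le> B x \<bullet> x"
  shows "\<exists>p m \<epsilon> \<delta>. local_resolvent (limiting_subdifferential g) B p m xbar vhat \<epsilon> \<delta>"
proof -
  define q where "q x = B x \<bullet> x / 2" for x
  define ybar where "ybar = vhat + B xbar"
  let ?K = "cball xbar \<rho>"
  interpret B: bounded_linear B by fact
  have q: "q x = q u + B u \<bullet> (x - u) + B (x - u) \<bullet> (x - u) / 2" for x u
    using sym[of x u] by (simp add: q_def B.diff inner_diff_left inner_diff_right inner_commute field_simps)
  obtain K where K: "K > 0" "\<And>x. norm (B x) \<le> norm x * K" using B.pos_bounded by blast
  define good where "good y u \<longleftrightarrow> u \<in> ?K \<and> (\<exists>a. g u = ereal a \<and>
     (\<forall>x\<in>?K. ereal (a + q u + y \<bullet> (x - u) + (norm (x - u))\<^sup>2 / 2) \<le> g x + ereal (q x)))" for y u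
  have goodI: "good (v + B u) u"
    if u: "u \<in> ?K" and v: "v \<in> limiting_subdifferential g u" "dist v vhat < \<rho>" for u v
  proof -
    have "g u < \<infinity>" using v by (simp add: limiting_subdifferential_def)
    then obtain a where a: "g u = ereal a" using ninf by (cases "g u") auto
    have "ereal (a + q u + (v + B u) \<bullet> (x - u) + (norm (x - u))\<^sup>2 / 2) \<le> g x + ereal (q x)"
      if x: "x \<in> ?K" for x
    proof (cases "g x")
      case (real b)
      have "a + (v \<bullet> (x - u) - r / 2 * (norm (x - u))\<^sup>2) \<le> b" using growth[OF u v x] a real by simp
      then show ?thesis using pos[of "x - u"] q[of x u] real
        by (simp add: inner_add_left field_simps)
    qed (use ninf in auto)
    then show ?thesis using a u by (auto simp: good_def)
  qed
  have good2: "real_of_ereal (g x) + q x \<ge> real_of_ereal (g u) + q u + y \<bullet> (x - u) + (norm (x - u))\<^sup>2 / 2"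
    if gu: "good y u" and gx: "good y' x" for y u y' x
  proof -
    obtain a where a: "g u = ereal a"
      "\<And>x. x \<in> ?K \<Longrightarrow> ereal (a + q u + y \<bullet> (x - u) + (norm (x - u))\<^sup>2 / 2) \<le> g x + ereal (q x)"
      using gu unfolding good_def by blast
    obtain b where b: "g x = ereal b" "x \<in> ?K" using gx unfolding good_def by blast
    show ?thesis using a(2)[OF b(2)] a(1) b(1) by simp
  qed
  have mono: "(norm (u - u'))\<^sup>2 \<le> (y - y') \<bullet> (u - u')" if "good y u" "good y' u'" for y y' u u'
    using good2[OF that] good2[OF that(2,1)]
    by (simp add: inner_diff_left inner_diff_right norm_minus_commute)
  have nonexp: "norm (u - u') \<le> norm (y - y')" if "good y u" "good y' u'" for y y' u u'
    by (rule square_le_cauchy[OF mono[OF that]])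
  have xK: "xbar \<in> ?K" using \<rho> by simp
  have gbar: "good ybar xbar" unfolding ybar_def using goodI[OF xK vhat] \<rho> by simp
  \<comment> \<open>A minimizer \<open>u\<close> for \<open>y\<close> satisfies \<open>|u - xbar| \<le> 2 |y - ybar|\<close>; then \<open>y - B u\<close> is within \<open>(1 + 2 K) |y - ybar|\<close> of \<open>vhat\<close>.\<close>
  define \<epsilon> where "\<epsilon> = \<rho> / (2 * (1 + 2 * K))"
  have \<epsilon>: "\<epsilon> > 0" "(1 + 2 * K) * \<epsilon> = \<rho> / 2" using \<rho> K by (auto simp: \<epsilon>_def field_simps)
  have \<epsilon>2: "2 * \<epsilon> \<le> \<rho>" "\<epsilon> + 2 * \<epsilon> * K < \<rho>" using \<epsilon> K \<rho> by (auto simp: algebra_simps)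
  have ex: "\<exists>u. good y u \<and> y - B u \<in> limiting_subdifferential g u" if y: "y \<in> ball ybar \<epsilon>" for y
  proof -
    let ?F = "\<lambda>x. g x + ereal (q x - y \<bullet> x)"
    have cont: "continuous_on UNIV (\<lambda>x. q x - y \<bullet> x)"
      unfolding q_def by (intro continuous_intros B.continuous_on) simp
    have "\<exists>u\<in>?K. \<forall>x\<in>?K. ?F u \<le> ?F x"
    proof (rule compact_attains_min_lsc)
      show "compact ?K" "?K \<noteq> {}" using xK by auto
      show "\<exists>S. open S \<and> x \<in> S \<and> (\<forall>x'\<in>S \<inter> ?K. c < ?F x')" if "c < ?F x" for x c
        using lsc_add_continuous[OF ninf lsc cont that] by blast
    qed
    then obtain u where u: "u \<in> ?K" and min: "\<And>x. x \<in> ?K \<Longrightarrow> ?F u \<le> ?F x" by blast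
    obtain a where a: "g xbar = ereal a"
      and gx: "\<And>x. x \<in> ?K \<Longrightarrow> ereal (a + q xbar + ybar \<bullet> (x - xbar) + (norm (x - xbar))\<^sup>2 / 2) \<le> g x + ereal (q x)"
      using gbar by (auto simp: good_def)
    obtain b where b: "g u = ereal b" using min[OF xK] a ninf by (cases "g u") auto
    have "(norm (u - xbar))\<^sup>2 / 2 \<le> (y - ybar) \<bullet> (u - xbar)"
      using min[OF xK] gx[OF u] a b by (simp add: inner_diff_left inner_diff_right)
    then have "(norm (u - xbar))\<^sup>2 \<le> (2 *\<^sub>R (y - ybar)) \<bullet> (u - xbar)" by simp
    then have "norm (u - xbar) \<le> norm (2 *\<^sub>R (y - ybar))" by (rule square_le_cauchy)
    then have nu: "norm (u - xbar) < 2 * \<epsilon>" using y by (simp add: dist_norm norm_minus_commute)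
    have v: "y - B u \<in> frechet_subdifferential g u"
    proof (rule frechet_subgradientI)
      show "g u \<noteq> \<infinity>" "g u \<noteq> - \<infinity>" using b by auto
      show "0 < \<rho> - norm (u - xbar)" using nu \<epsilon>2 by simp
      fix x assume x: "dist x u < \<rho> - norm (u - xbar)"
      have xK: "x \<in> ?K" using x dist_triangle[of x xbar u] by (simp add: dist_norm norm_minus_commute)
      have "B (x - u) \<bullet> (x - u) \<le> norm (B (x - u)) * norm (x - u)" by (rule norm_cauchy_schwarz)
      also have "\<dots> \<le> (norm (x - u) * K) * norm (x - u)" by (intro mult_right_mono K) simp
      finally have *: "B (x - u) \<bullet> (x - u) \<le> K * (norm (x - u))\<^sup>2"
        by (simp add: power2_eq_square ac_simps)
      show "g x \<ge> g u + ereal ((y - B u) \<bullet> (x - u) - K / 2 * (norm (x - u))\<^sup>2)"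
      proof (cases "g x")
        case (real c)
        have m: "b + (q u - y \<bullet> u) \<le> c + (q x - y \<bullet> x)" using min[OF xK] b real by simp
        have "b + (y \<bullet> (x - u) - B u \<bullet> (x - u)) - B (x - u) \<bullet> (x - u) / 2 \<le> c"
          using m unfolding q[of x u] inner_diff_right[of y] by linarith
        then have "b + ((y - B u) \<bullet> (x - u) - K / 2 * (norm (x - u))\<^sup>2) \<le> c"
          using * unfolding inner_diff_left[of y] by linarith
        then show ?thesis using real b by simp
      qed (use ninf in auto)
    qed
    have "y - B u - vhat = (y - ybar) - B (u - xbar)" by (simp add: ybar_def B.diff)
    then have "norm (y - B u - vhat) \<le> norm (y - ybar) + norm (B (u - xbar))"
      by (metis norm_triangle_ineq4)
    also have "\<dots> \<le> norm (y - ybar) + norm (u - xbar) * K" using K by simp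
    also have "\<dots> \<le> \<epsilon> + (2 * \<epsilon>) * K"
      using y nu K by (intro add_mono mult_right_mono) (auto simp: dist_norm norm_minus_commute)
    finally have "dist (y - B u) vhat < \<rho>" using \<epsilon>2 by (simp add: dist_norm)
    moreover have v': "y - B u \<in> limiting_subdifferential g u" using v frechet_subset_limiting by blast
    ultimately have "good (y - B u + B u) u" using goodI u by blast
    then show ?thesis using v' by auto
  qed
  define p where "p y = (SOME u. good y u)" for y
  have p: "p y = u" if "good y u" for y u
  proof -
    have "good y (p y)" unfolding p_def by (rule someI[of "good y", OF that])
    then show ?thesis using nonexp[OF that] by fastforce
  qed
  have pg: "good y (p y)" "y - B (p y) \<in> limiting_subdifferential g (p y)" if "y \<in> ball ybar \<epsilon>" for y
    using ex[OF that] p by auto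
  define m where "m y = y \<bullet> p y - (real_of_ereal (g (p y)) + q (p y))" for y
  define \<delta> where "\<delta> = min \<rho> (\<epsilon> / (1 + K))"
  have \<delta>: "\<delta> > 0" "\<delta> \<le> \<rho>" "\<delta> * (1 + K) \<le> \<epsilon>"
  proof -
    have "\<delta> \<le> \<epsilon> / (1 + K)" by (simp add: \<delta>_def)
    then show "\<delta> * (1 + K) \<le> \<epsilon>" using K(1) by (simp add: pos_le_divide_eq)
  qed (use \<rho> \<epsilon>(1) K(1) in \<open>auto simp: \<delta>_def\<close>)
  have "local_resolvent (limiting_subdifferential g) B p m xbar vhat \<epsilon> \<delta>"
  proof (unfold_locales, fold ybar_def)
    show "0 < \<epsilon>" "0 < \<delta>" by fact+
    show "p ybar = xbar" using p gbar by blast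
    show "y - B (p y) \<in> limiting_subdifferential g (p y)" if "y \<in> ball ybar \<epsilon>" for y
      using pg that by blast
    show "1-lipschitz_on (ball ybar \<epsilon>) p"
      by (rule lipschitz_onI) (use nonexp pg in \<open>auto simp: dist_norm\<close>)
    show "m y + p y \<bullet> (z - y) \<le> m z" if "y \<in> ball ybar \<epsilon>" "z \<in> ball ybar \<epsilon>" for y z
    proof -
      have "real_of_ereal (g (p y)) + q (p y) \<ge> real_of_ereal (g (p z)) + q (p z)
          + z \<bullet> (p y - p z) + (norm (p y - p z))\<^sup>2 / 2"
        by (rule good2[OF pg(1)[OF that(2)] pg(1)[OF that(1)]])
      moreover have "0 \<le> (norm (p y - p z))\<^sup>2 / 2" by simp
      ultimately show ?thesis
        unfolding m_def inner_diff_right inner_commute[of "p y"] by linarith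
    qed
    fix u v assume v: "v \<in> limiting_subdifferential g u" and d: "dist u xbar < \<delta>" "dist v vhat < \<delta>"
    have "v + B u - ybar = (v - vhat) + B (u - xbar)" by (simp add: ybar_def B.diff)
    then have "norm (v + B u - ybar) \<le> norm (v - vhat) + norm (B (u - xbar))"
      by (metis norm_triangle_ineq)
    also have "\<dots> \<le> norm (v - vhat) + norm (u - xbar) * K" using K by simp
    also have "\<dots> < \<delta> + \<delta> * K"
      using d K by (intro add_less_le_mono mult_right_mono) (auto simp: dist_norm)
    finally have "v + B u \<in> ball ybar \<epsilon>" using \<delta> by (simp add: dist_norm norm_minus_commute distrib_left)
    moreover have "u \<in> ?K" "dist v vhat < \<rho>" using d \<delta> by (auto simp: dist_commute)
    then have "p (v + B u) = u" using goodI v p by blast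
    ultimately show "v + B u \<in> ball ybar \<epsilon> \<and> p (v + B u) = u" by blast
  qed
  then show ?thesis by blast
qed

section \<open>Strongly monotone mappings with a local inverse\<close>

definition strongly_monotone_on :: "('a::real_inner \<times> 'a) set \<Rightarrow> real \<Rightarrow> bool" where
  "strongly_monotone_on M \<kappa> \<longleftrightarrow> (\<forall>(u1, v1) \<in> M. \<forall>(u2, v2) \<in> M.
      (v1 - v2) \<bullet> (u1 - u2) \<ge> \<kappa> * (norm (u1 - u2))\<^sup>2)"

lemma strongly_monotone_onD:
  "strongly_monotone_on M \<kappa> \<Longrightarrow> (u1, v1) \<in> M \<Longrightarrow> (u2, v2) \<in> M \<Longrightarrow>
    \<kappa> * (norm (u1 - u2))\<^sup>2 \<le> (v1 - v2) \<bullet> (u1 - u2)"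
  unfolding strongly_monotone_on_def by fast

text \<open>
  The box \<open>U \<times> W\<close> is fitted to the inverse: \<open>s\<close> is defined on all of \<open>W\<close>, and \<open>U\<close> is large enough to
  contain its values.  Maximality can then be tested at every point of the box, also where a point
  of \<open>U\<close> is close to the boundary, because the comparison points \<open>(s w', w')\<close> never leave the box.
\<close>

locale strongly_monotone_inverse =
  fixes T :: "'a::euclidean_space \<Rightarrow> 'a set" and \<kappa> :: real and U W :: "'a set"
    and s :: "'a \<Rightarrow> 'a"
  assumes kappa: "\<kappa> > 0" and mono: "strongly_monotone_on (gph T \<inter> (U \<times> W)) \<kappa>"
    and U: "open U" and W: "open W"
    and s: "\<And>w. w \<in> W \<Longrightarrow> s w \<in> U \<and> w \<in> T (s w)"
begin

lemma s_gph: "w \<in> W \<Longrightarrow> (s w, w) \<in> gph T \<inter> (U \<times> W)"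
  using s by (simp add: gph_def)

lemma s_cocoercive: "w1 \<in> W \<Longrightarrow> w2 \<in> W \<Longrightarrow> \<kappa> * (norm (s w1 - s w2))\<^sup>2 \<le> (w1 - w2) \<bullet> (s w1 - s w2)"
  using strongly_monotone_onD[OF mono s_gph s_gph] by blast

lemma s_lipschitz:
  assumes "w1 \<in> W" "w2 \<in> W"
  shows "norm (s w1 - s w2) \<le> norm (w1 - w2) / \<kappa>"
proof -
  have "(norm (s w1 - s w2))\<^sup>2 \<le> ((1 / \<kappa>) *\<^sub>R (w1 - w2)) \<bullet> (s w1 - s w2)"
    using s_cocoercive[OF assms] kappa
    unfolding inner_scaleR_left by (simp add: pos_le_divide_eq mult.commute)
  from square_le_cauchy[OF this] show ?thesis using kappa by simp
qed

lemma s_unique: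
  assumes "u \<in> U" "w \<in> W" "w \<in> T u"
  shows "u = s w"
proof -
  have "\<kappa> * (norm (u - s w))\<^sup>2 \<le> (w - w) \<bullet> (u - s w)"
    by (rule strongly_monotone_onD[OF mono _ s_gph]) (use assms in \<open>auto simp: gph_def\<close>)
  then show ?thesis using kappa by (simp add: mult_le_0_iff)
qed

text \<open>
  Minty's argument: if \<open>(x, w)\<close> belongs to a monotone extension \<open>S\<close>, compare it with the graph point
  over \<open>w + t (x - s w)\<close> for a small \<open>t > 0\<close>.  This point lies in \<open>W\<close> since \<open>W\<close> is open, and
  monotonicity of \<open>S\<close> together with the Lipschitz continuity of \<open>s\<close> gives \<open>|x - s w|\<^sup>2 \<le> |x - s w|\<^sup>2 / 2\<close>.
\<close>

lemma locally_strongly_maximally_monotone: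
  assumes "xbar \<in> U" "vbar \<in> W"
  shows "locally_strongly_maximally_monotone T xbar vbar"
proof -
  have "gph T \<inter> (U \<times> W) = gph S \<inter> (U \<times> W)"
    if S: "monotone_operator S" and sub: "gph T \<inter> (U \<times> W) \<subseteq> gph S" for S
  proof
    show "gph T \<inter> (U \<times> W) \<subseteq> gph S \<inter> (U \<times> W)" using sub by blast
    have "(x, w) \<in> gph T" if x: "(x, w) \<in> gph S" "x \<in> U" "w \<in> W" for x w
    proof -
      define h where "h = x - s w"
      obtain e where e: "e > 0" "ball w e \<subseteq> W" using W x(3) open_contains_ball by blast
      define t where "t = min (\<kappa> / 2) (e / (2 * (norm h + 1)))"
      have t: "t > 0" "t \<le> \<kappa> / 2" using kappa e unfolding t_def
        by (simp_all only: min_less_iff_conj min.cobounded1) (simp add: add_nonneg_pos)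
      have "t * (norm h + 1) \<le> e / 2"
      proof -
        have "t \<le> e / (2 * (norm h + 1))" by (simp add: t_def)
        moreover have "norm h + 1 > 0" by (simp add: add_nonneg_pos)
        ultimately show ?thesis by (simp add: field_simps)
      qed
      then have "t * norm h < e" using e t by (simp add: distrib_left)
      then have w': "w + t *\<^sub>R h \<in> W" using e t by (auto simp: dist_norm)
      define k where "k = s (w + t *\<^sub>R h) - s w"
      have "(s (w + t *\<^sub>R h), w + t *\<^sub>R h) \<in> gph S" using s_gph[OF w'] sub by blast
      then have "(w - (w + t *\<^sub>R h)) \<bullet> (x - s (w + t *\<^sub>R h)) \<ge> 0"
        using S x(1) unfolding monotone_operator_def by fast
      moreover have "x - s (w + t *\<^sub>R h) = h - k" by (simp add: h_def k_def)
      ultimately have "t * (h \<bullet> (h - k)) \<le> 0" by simp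
      then have "h \<bullet> (h - k) \<le> 0" using t by (simp add: mult_le_0_iff)
      then have "(norm h)\<^sup>2 \<le> h \<bullet> k" by (simp add: inner_diff_right power2_norm_eq_inner)
      also have "\<dots> \<le> norm h * norm k" by (rule norm_cauchy_schwarz)
      also have "norm k \<le> t * norm h / \<kappa>" using s_lipschitz[OF w' x(3)] t by (simp add: k_def)
      also have "\<dots> \<le> (\<kappa> / 2) * norm h / \<kappa>"
        using t kappa by (intro divide_right_mono mult_right_mono) auto
      also have "\<dots> = norm h / 2" using kappa by simp
      finally have "(norm h)\<^sup>2 \<le> (norm h)\<^sup>2 / 2" by (simp add: power2_eq_square mult_left_mono)
      then have "h = 0" by simp
      then show ?thesis using s_gph[OF x(3)] by (simp add: h_def)
    qed
    then show "gph S \<inter> (U \<times> W) \<subseteq> gph T \<inter> (U \<times> W)" by auto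
  qed
  then show ?thesis
    unfolding locally_strongly_maximally_monotone_def strongly_monotone_on_def[symmetric]
    using kappa mono assms U W
    by (intro exI[of _ \<kappa>] conjI exI[of _ U] exI[of _ W]) (auto simp: interior_open)
qed

text \<open>
  Test the normal along \<open>t \<mapsto> (s (w + t e), w + t e)\<close> with \<open>e = z - 2 \<kappa> a\<close>.  The cocoercivity of \<open>s\<close>
  says that the reflection \<open>r = t e - 2 \<kappa> h\<close> of the increment \<open>h\<close> satisfies \<open>|r| \<le> t |e|\<close>.  In
  terms of \<open>r\<close>, the normality of \<open>(z, - a)\<close> reads \<open>t |e|\<^sup>2 \<le> \<langle>z, r\<rangle> + o(t)\<close>, whence \<open>|e| \<le> |z|\<close>, and
  expanding the square of this inequality gives the estimate.
\<close>

lemma frechet_normal_estimate: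
  assumes w: "w \<in> W" and n: "(z, - a) \<in> frechet_normal_cone (gph T) (s w, w)"
  shows "z \<bullet> a \<ge> \<kappa> * (norm a)\<^sup>2"
proof -
  define e where "e = z - (2 * \<kappa>) *\<^sub>R a"
  define c where "c = norm e / \<kappa> + norm e"
  have c: "c \<ge> 0" using kappa by (simp add: c_def)
  have key: "(norm e)\<^sup>2 \<le> norm z * norm e + 2 * \<kappa> * \<epsilon> * c" if \<epsilon>: "\<epsilon> > 0" for \<epsilon>
  proof -
    obtain d where d: "d > 0" "\<And>z'. z' \<in> gph T \<Longrightarrow> dist z' (s w, w) < d \<Longrightarrow>
        (z, - a) \<bullet> (z' - (s w, w)) \<le> \<epsilon> * norm (z' - (s w, w))"
      using n \<epsilon> unfolding frechet_normal_cone_iff by blast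
    obtain b where b: "b > 0" "ball w b \<subseteq> W" using W w open_contains_ball by blast
    define t where "t = min b d / (2 * (norm e + c + 1))"
    have pos: "norm e + c + 1 > 0" using c by (simp add: add_nonneg_pos)
    then have t: "t > 0" using b d by (simp add: t_def)
    have "t * (norm e + c + 1) = min b d / 2" using pos by (simp add: t_def field_simps)
    then have "t * norm e + t * c + t \<le> b / 2" "t * norm e + t * c + t \<le> d / 2"
      by (auto simp: distrib_left)
    moreover have "t * norm e \<ge> 0" "t * c \<ge> 0" using t c by auto
    ultimately have te: "t * norm e < b" and tc: "t * c < d" using t b d by linarith+
    have w': "w + t *\<^sub>R e \<in> W" using b t te by (auto simp: dist_norm)
    define h where "h = s (w + t *\<^sub>R e) - s w"
    have "norm h \<le> t * norm e / \<kappa>" using s_lipschitz[OF w' w] t by (simp add: h_def)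
    then have nh: "norm h + t * norm e \<le> t * c" by (simp add: c_def distrib_left)
    have mon: "\<kappa> * (norm h)\<^sup>2 \<le> t * (e \<bullet> h)" using s_cocoercive[OF w' w] by (simp add: h_def)
    let ?z' = "(s (w + t *\<^sub>R e), w + t *\<^sub>R e)"
    have z': "?z' - (s w, w) = (h, t *\<^sub>R e)" by (simp add: h_def)
    have "norm (h, t *\<^sub>R e) \<le> norm h + norm (t *\<^sub>R e)" by (rule norm_Pair_le)
    also have "\<dots> \<le> t * c" using nh t by simp
    finally have nz: "norm (?z' - (s w, w)) \<le> t * c" unfolding z' .
    have "(z, - a) \<bullet> (?z' - (s w, w)) \<le> \<epsilon> * norm (?z' - (s w, w))"
      using s_gph[OF w'] nz tc by (intro d) (auto simp: dist_norm)
    also have "\<dots> \<le> \<epsilon> * (t * c)" using nz \<epsilon> by (intro mult_left_mono) auto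
    finally have est: "z \<bullet> h - t * (a \<bullet> e) \<le> \<epsilon> * (t * c)" unfolding z' by simp
    define r where "r = t *\<^sub>R e - (2 * \<kappa>) *\<^sub>R h"
    have "(norm r)\<^sup>2 = (t * norm e)\<^sup>2 - 4 * \<kappa> * (t * (e \<bullet> h) - \<kappa> * (norm h)\<^sup>2)"
      unfolding r_def power_mult_distrib power2_norm_eq_inner
      by (simp add: inner_diff_left inner_diff_right inner_commute power2_eq_square algebra_simps)
    also have "\<dots> \<le> (t * norm e)\<^sup>2" using mon kappa by simp
    finally have nr: "norm r \<le> t * norm e" using t by (simp add: power2_le_iff_abs_le)
    have "t * (norm e)\<^sup>2 = t * (z \<bullet> e) - 2 * \<kappa> * (t * (a \<bullet> e))"
      by (simp add: e_def power2_norm_eq_inner inner_diff_left inner_diff_right algebra_simps)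
    also have "t * (z \<bullet> e) = z \<bullet> r + 2 * \<kappa> * (z \<bullet> h)" by (simp add: r_def inner_diff_right)
    finally have "t * (norm e)\<^sup>2 = z \<bullet> r + 2 * \<kappa> * (z \<bullet> h - t * (a \<bullet> e))"
      by (simp add: right_diff_distrib)
    also have "\<dots> \<le> norm z * (t * norm e) + 2 * \<kappa> * (\<epsilon> * (t * c))"
    proof (intro add_mono mult_left_mono est)
      show "z \<bullet> r \<le> norm z * (t * norm e)"
        using norm_cauchy_schwarz[of z r] nr by (meson mult_left_mono norm_ge_zero order_trans)
    qed (use kappa in simp)
    also have "\<dots> = t * (norm z * norm e + 2 * \<kappa> * \<epsilon> * c)" by (simp add: algebra_simps)
    finally show ?thesis using t by simp
  qed
  have "norm e * norm e \<le> norm z * norm e"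
  proof (rule field_le_epsilon)
    fix \<gamma> :: real assume \<gamma>: "0 < \<gamma>"
    have "(norm e)\<^sup>2 \<le> norm z * norm e + 2 * \<kappa> * (\<gamma> / (2 * \<kappa> * (c + 1))) * c"
      using c kappa \<gamma> by (intro key) auto
    also have "2 * \<kappa> * (\<gamma> / (2 * \<kappa> * (c + 1))) * c = \<gamma> * (c / (c + 1))" using kappa c by simp
    also have "\<dots> \<le> \<gamma> * 1" using c \<gamma> by (intro mult_left_mono) auto
    finally show "norm e * norm e \<le> norm z * norm e + \<gamma>" by (simp add: power2_eq_square)
  qed
  then have "norm e \<le> norm z" by (cases "e = 0") auto
  then have "(norm e)\<^sup>2 \<le> (norm z)\<^sup>2" by (simp add: power_mono)
  also have "(norm e)\<^sup>2 = (norm z)\<^sup>2 - 4 * \<kappa> * (z \<bullet> a - \<kappa> * (norm a)\<^sup>2)"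
    unfolding e_def power2_norm_eq_inner
    by (simp add: inner_diff_left inner_diff_right inner_commute power2_eq_square algebra_simps)
  finally have "0 \<le> \<kappa> * (z \<bullet> a - \<kappa> * (norm a)\<^sup>2)" by simp
  then show ?thesis using kappa by (simp add: zero_le_mult_iff)
qed

lemma coderivative_positive_definite:
  assumes "xbar \<in> U" "vbar \<in> W"
  shows "positive_definite_mapping (limiting_coderivative T xbar vbar)"
  unfolding positive_definite_mapping_def
proof (intro allI impI, elim conjE)
  fix a z assume z: "z \<in> limiting_coderivative T xbar vbar a" and a: "a \<noteq> 0"
  obtain zs \<zeta>s where zs: "\<And>k::nat. zs k \<in> gph T" "\<And>k. \<zeta>s k \<in> frechet_normal_cone (gph T) (zs k)"
    "zs \<longlonglongrightarrow> (xbar, vbar)" "\<zeta>s \<longlonglongrightarrow> (z, - a)"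
    using z unfolding limiting_coderivative_def limiting_normal_cone_def by blast
  have "open (U \<times> W)" using U W by (rule open_Times)
  then have "\<forall>\<^sub>F k in sequentially. zs k \<in> U \<times> W" using zs(3) assms by (simp add: topological_tendstoD)
  then have ev: "\<forall>\<^sub>F k in sequentially.
      \<kappa> * (norm (- snd (\<zeta>s k)))\<^sup>2 \<le> fst (\<zeta>s k) \<bullet> (- snd (\<zeta>s k))"
  proof eventually_elim
    case (elim k)
    have g: "zs k = (fst (zs k), snd (zs k))" by simp
    have "snd (zs k) \<in> T (fst (zs k))" using zs(1)[of k] by (auto simp: gph_def)
    then have "fst (zs k) = s (snd (zs k))" using s_unique elim by (auto simp: mem_Times_iff)
    then have "(fst (\<zeta>s k), - (- snd (\<zeta>s k))) \<in> frechet_normal_cone (gph T) (s (snd (zs k)), snd (zs k))"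
      using zs(2)[of k] g by (metis minus_minus prod.collapse)
    then show ?case using elim by (intro frechet_normal_estimate) (auto simp: mem_Times_iff)
  qed
  have l1: "(\<lambda>k. \<kappa> * (norm (- snd (\<zeta>s k)))\<^sup>2) \<longlonglongrightarrow> \<kappa> * (norm (- snd (z, - a)))\<^sup>2"
    by (intro tendsto_intros zs(4))
  have l2: "(\<lambda>k. fst (\<zeta>s k) \<bullet> (- snd (\<zeta>s k))) \<longlonglongrightarrow> fst (z, - a) \<bullet> (- snd (z, - a))"
    by (intro tendsto_intros zs(4))
  have "\<kappa> * (norm a)\<^sup>2 \<le> z \<bullet> a"
    using tendsto_le[OF sequentially_bot l2 l1 ev] by simp
  moreover have "\<kappa> * (norm a)\<^sup>2 > 0" using kappa a by simp
  ultimately show "0 < z \<bullet> a" by linarith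
qed

end

text \<open>
  Two parameters with the same value \<open>E y\<close> have the same point \<open>P y\<close> by strong monotonicity, so \<open>E\<close> is
  injective near \<open>c\<close>, and invariance of domain makes its image a neighborhood of \<open>vbar\<close>.
\<close>

lemma strongly_monotone_inverse_exists:
  fixes T :: "'a::euclidean_space \<Rightarrow> 'a set" and P E :: "'a \<Rightarrow> 'a"
  assumes \<kappa>: "\<kappa> > 0" and mono: "strongly_monotone_on (gph T \<inter> (U \<times> V)) \<kappa>"
    and UV: "xbar \<in> interior U" "vbar \<in> interior V"
    and S: "open S" "c \<in> S" and P: "continuous_on S P" "P c = xbar" and E: "continuous_on S E" "E c = vbar"
    and PE: "\<And>y. y \<in> S \<Longrightarrow> E y \<in> T (P y)"
    and inj: "inj_on (\<lambda>y. (P y, E y)) S"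
  shows "\<exists>W s. strongly_monotone_inverse T \<kappa> (interior U) W s \<and> xbar \<in> interior U \<and> vbar \<in> W"
proof -
  define S' where "S' = S \<inter> P -` interior U \<inter> (S \<inter> E -` interior V)"
  have "open S'" unfolding S'_def
    by (intro open_Int continuous_open_preimage P(1) E(1) S open_interior)
  have S': "S' \<subseteq> S" "c \<in> S'" "\<And>y. y \<in> S' \<Longrightarrow> P y \<in> interior U \<and> E y \<in> interior V"
    using S P E UV by (auto simp: S'_def)
  have in_gph: "(P y, E y) \<in> gph T \<inter> (U \<times> V)" if "y \<in> S'" for y
    using S'(1) S'(3)[OF that] PE that interior_subset[of U] interior_subset[of V] by (auto simp: gph_def)
  have injE: "inj_on E S'"
  proof (rule inj_onI)
    fix y y' assume y: "y \<in> S'" "y' \<in> S'" "E y = E y'"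
    have "\<kappa> * (norm (P y - P y'))\<^sup>2 \<le> (E y - E y') \<bullet> (P y - P y')"
      by (rule strongly_monotone_onD[OF mono in_gph in_gph]) fact+
    then have "P y = P y'" using \<kappa> y by (simp add: mult_le_0_iff)
    then show "y = y'" using inj y S' by (auto simp: inj_on_def)
  qed
  have W: "open (E ` S')"
    by (rule invariance_of_domain[OF continuous_on_subset[OF E(1) S'(1)] \<open>open S'\<close> injE])
  define s where "s w = P (inv_into S' E w)" for w
  have "strongly_monotone_inverse T \<kappa> (interior U) (E ` S') s"
  proof
    show "strongly_monotone_on (gph T \<inter> (interior U \<times> E ` S')) \<kappa>"
      using mono interior_subset[of U] interior_subset[of V] S'(3)
      unfolding strongly_monotone_on_def by blast
    show "s w \<in> interior U \<and> w \<in> T (s w)" if "w \<in> E ` S'" for w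
      using that S'(1,3) PE injE by (auto simp: s_def)
  qed (use \<kappa> W in auto)
  then show ?thesis using UV S' E by blast
qed

section \<open>Smooth perturbations of the resolvent\<close>

text \<open>
  The mean value inequality for \<open>f - f' xbar\<close>, whose derivative is small near \<open>xbar\<close>.
\<close>

lemma continuous_imp_strict_derivative:
  fixes f :: "'a::real_normed_vector \<Rightarrow> 'b::real_normed_vector"
  assumes U: "open U" "xbar \<in> U"
    and der: "\<And>x. x \<in> U \<Longrightarrow> (f has_derivative blinfun_apply (f' x)) (at x)"
    and cont: "continuous_on U f'" and e: "e > 0"
  shows "\<exists>d>0. ball xbar d \<subseteq> U \<and> (\<forall>x\<in>ball xbar d. \<forall>y\<in>ball xbar d.
    norm (f x - f y - blinfun_apply (f' xbar) (x - y)) \<le> e * norm (x - y))"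
proof -
  have "isCont f' xbar" using cont U by (simp add: continuous_on_eq_continuous_at)
  then obtain d1 where d1: "d1 > 0" "\<And>x. dist x xbar < d1 \<Longrightarrow> dist (f' x) (f' xbar) < e"
    using e unfolding continuous_at_eps_delta by blast
  obtain d2 where d2: "d2 > 0" "ball xbar d2 \<subseteq> U" using U open_contains_ball by blast
  define d where "d = min d1 d2"
  have d: "d > 0" "ball xbar d \<subseteq> U" using d1 d2 by (auto simp: d_def)
  have "norm (f x - f y - blinfun_apply (f' xbar) (x - y)) \<le> e * norm (x - y)"
    if xy: "x \<in> ball xbar d" "y \<in> ball xbar d" for x y
  proof -
    let ?h = "\<lambda>x. f x - blinfun_apply (f' xbar) x"
    have "norm (?h x - ?h y) \<le> e * norm (x - y)"
    proof (rule differentiable_bound[OF convex_ball _ _ xy])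
      fix z assume z: "z \<in> ball xbar d"
      have "(?h has_derivative (\<lambda>v. blinfun_apply (f' z) v - blinfun_apply (f' xbar) v)) (at z)"
        by (intro derivative_intros der bounded_linear_imp_has_derivative blinfun.bounded_linear_right)
           (use d z in auto)
      then show "(?h has_derivative blinfun_apply (f' z - f' xbar)) (at z within ball xbar d)"
        by (simp add: minus_blinfun.rep_eq fun_diff_def has_derivative_at_withinI)
      show "onorm (blinfun_apply (f' z - f' xbar)) \<le> e"
        using d1(2)[of z] z by (simp add: d_def dist_norm norm_blinfun.rep_eq[symmetric] norm_minus_commute)
    qed
    then show ?thesis by (simp add: blinfun.diff_right algebra_simps)
  qed
  then show ?thesis using d by blast
qed

lemma tendsto_adjoint_blinfun:
  fixes F :: "'b \<Rightarrow> 'a::euclidean_space \<Rightarrow>\<^sub>L 'a"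
  assumes F: "(F \<longlongrightarrow> F0) net" and x: "(x \<longlongrightarrow> x0) net"
  shows "((\<lambda>k. adjoint (blinfun_apply (F k)) (x k)) \<longlongrightarrow> adjoint (blinfun_apply F0) x0) net"
proof (subst tendsto_componentwise_iff, intro ballI)
  fix b :: 'a assume "b \<in> Basis"
  have adj: "adjoint (blinfun_apply A) v \<bullet> b = v \<bullet> blinfun_apply A b" for A :: "'a \<Rightarrow>\<^sub>L 'a" and v
    by (simp add: adjoint_clauses bounded_linear.linear[OF blinfun.bounded_linear_right])
  show "((\<lambda>k. adjoint (blinfun_apply (F k)) (x k) \<bullet> b) \<longlongrightarrow> adjoint (blinfun_apply F0) x0 \<bullet> b) net"
    unfolding adj by (intro tendsto_intros F x)
qed

locale smoothly_perturbed_resolvent = local_resolvent G B p m xbar vhat \<epsilon> \<delta>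
  for G :: "'a::euclidean_space \<Rightarrow> 'a set" and B p m xbar vhat \<epsilon> \<delta> +
  fixes f :: "'a \<Rightarrow> 'a" and f' :: "'a \<Rightarrow> 'a \<Rightarrow>\<^sub>L 'a" and U0 :: "'a set" and \<sigma> :: real
  assumes U0: "open U0" "xbar \<in> U0"
    and deriv: "\<And>x. x \<in> U0 \<Longrightarrow> (f has_derivative blinfun_apply (f' x)) (at x)"
    and cont: "continuous_on U0 f'"
    and sigma: "\<sigma> > 0"
    and B_sym: "\<And>x y. B x \<bullet> y = x \<bullet> B y"
    and B_quad: "\<And>x. B x \<bullet> x = blinfun_apply (f' xbar) x \<bullet> x + \<sigma> * (norm x)\<^sup>2"
begin

definition T :: "'a \<Rightarrow> 'a set" where "T = (\<lambda>x. {f x + v | v. v \<in> G x})"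
definition vbar :: 'a where "vbar = f xbar + vhat"
definition ybar :: 'a where "ybar = vhat + B xbar"

lemma ybar_mem: "ybar \<in> ball ybar \<epsilon>" using eps by simp

lemma p_ybar: "p ybar = xbar" by (simp add: ybar_def p_center)

lemma p_continuous: "continuous_on (ball ybar \<epsilon>) p"
  unfolding ybar_def by (rule lipschitz_on_continuous_on[OF p_lip])

lemma gph_T_iff: "(u, w) \<in> gph T \<longleftrightarrow> w - f u \<in> G u"
  by (auto simp: gph_def T_def) (metis add_diff_cancel_left' diff_add_cancel add.commute)

text \<open>
  Choose \<open>\<kappa>\<close> by \<open>1 / L' = \<sigma> + 2 \<kappa>\<close> for some \<open>L'\<close> between \<open>L\<close> and \<open>1 / \<sigma>\<close>.  In the chart
  \<open>y = (w - f u) + B u\<close> of \<open>T\<close>, cocoercivity of \<open>p\<close> reads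
  \<open>(\<sigma> + 2 \<kappa>) |h|\<^sup>2 \<le> \<langle>h, y1 - y2\<rangle>\<close> with \<open>h = u1 - u2\<close>.  The term \<open>\<langle>B h, h\<rangle>\<close> on the right equals
  \<open>\<langle>D h, h\<rangle> + \<sigma> |h|\<^sup>2\<close>; its first part cancels with \<open>f\<close> up to \<open>\<kappa> |h|\<^sup>2\<close>, by strict differentiability.
\<close>

lemma strongly_monotone_if_lipschitz:
  assumes L: "L < 1 / \<sigma>" "\<rho> > 0" "L-lipschitz_on (ball ybar \<rho>) p"
  shows "\<exists>\<kappa>>0. \<exists>\<eta>>0. strongly_monotone_on (gph T \<inter> (ball xbar \<eta> \<times> ball vbar \<eta>)) \<kappa>"
proof -
  interpret B: bounded_linear B by (rule B)
  have "max L 0 < 1 / \<sigma>" using L(1) sigma by simp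
  then obtain L' where "max L 0 < L'" "L' < 1 / \<sigma>" using dense by blast
  then have L': "0 < L'" "L \<le> L'" "L' < 1 / \<sigma>" by auto
  define \<kappa> where "\<kappa> = (1 / L' - \<sigma>) / 2"
  have \<kappa>: "\<kappa> > 0" "1 / L' = \<sigma> + 2 * \<kappa>" using L' sigma by (auto simp: \<kappa>_def field_simps)
  define \<rho>' where "\<rho>' = min \<rho> \<epsilon> / 3"
  have \<rho>': "\<rho>' > 0" "3 * \<rho>' \<le> \<rho>" "3 * \<rho>' \<le> \<epsilon>" using L(2) eps by (auto simp: \<rho>'_def)
  have coco: "(\<sigma> + 2 * \<kappa>) * (norm (p y1 - p y2))\<^sup>2 \<le> (p y1 - p y2) \<bullet> (y1 - y2)"
    if y: "y1 \<in> ball ybar \<rho>'" "y2 \<in> ball ybar \<rho>'" for y1 y2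
  proof -
    have "(norm (p y1 - p y2))\<^sup>2 \<le> L' * ((p y1 - p y2) \<bullet> (y1 - y2))"
    proof (rule local_cocoercivity[OF L'(1) _ _ y])
      show "L'-lipschitz_on (ball ybar (3 * \<rho>')) p"
        by (rule lipschitz_on_mono[OF L(3) _ L'(2)]) (use \<rho>' in auto)
      show "m y + p y \<bullet> (z - y) \<le> m z" if "y \<in> ball ybar (3 * \<rho>')" "z \<in> ball ybar (3 * \<rho>')" for y z
        by (rule p_sub) (use that \<rho>' in \<open>auto simp: ybar_def\<close>)
    qed
    then show ?thesis unfolding \<kappa>(2)[symmetric] using L'(1) by (simp add: field_simps)
  qed
  obtain d where d: "d > 0" "ball xbar d \<subseteq> U0"
    "\<And>x y. x \<in> ball xbar d \<Longrightarrow> y \<in> ball xbar d \<Longrightarrow>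
      norm (f x - f y - blinfun_apply (f' xbar) (x - y)) \<le> \<kappa> * norm (x - y)"
    using continuous_imp_strict_derivative[OF U0 deriv cont \<kappa>(1)] by blast
  obtain K where K: "K > 0" "\<And>x. norm (B x) \<le> norm x * K" using B.pos_bounded by blast
  have "isCont f xbar" using deriv[OF U0(2)] by (rule has_derivative_continuous)
  define a where "a = min \<delta> (\<rho>' / (1 + K))"
  have a: "a > 0" "a \<le> \<delta>" "a * (1 + K) \<le> \<rho>'"
  proof -
    have "a \<le> \<rho>' / (1 + K)" by (simp add: a_def)
    then show "a * (1 + K) \<le> \<rho>'" using K(1) by (simp add: pos_le_divide_eq)
  qed (use \<rho>'(1) del K(1) in \<open>auto simp: a_def\<close>)
  obtain b where b: "b > 0" "\<And>x. dist x xbar < b \<Longrightarrow> dist (f x) (f xbar) < a / 2"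
    using \<open>isCont f xbar\<close> a(1) unfolding continuous_at_eps_delta by (meson half_gt_zero)
  define \<eta> where "\<eta> = min (min d (a / 2)) b"
  have \<eta>: "\<eta> > 0" "\<eta> \<le> d" "\<eta> \<le> a / 2" "\<eta> \<le> b" using d a b by (auto simp: \<eta>_def)
  have chart: "w - f u + B u \<in> ball ybar \<rho>' \<and> p (w - f u + B u) = u"
    if uw: "(u, w) \<in> gph T" "u \<in> ball xbar \<eta>" "w \<in> ball vbar \<eta>" for u w
  proof -
    have u: "dist u xbar < a" using uw \<eta> a by (simp add: dist_commute)
    have "(w - f u) - vhat = (w - vbar) - (f u - f xbar)" by (simp add: vbar_def)
    then have "norm ((w - f u) - vhat) \<le> norm (w - vbar) + norm (f u - f xbar)"
      by (metis norm_triangle_ineq4)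
    also have "\<dots> < a / 2 + a / 2"
      using b(2)[of u] uw \<eta> by (intro add_strict_mono) (auto simp: dist_norm norm_minus_commute)
    finally have v: "dist (w - f u) vhat < a" by (simp add: dist_norm)
    have "w - f u + B u - ybar = ((w - f u) - vhat) + B (u - xbar)" by (simp add: ybar_def B.diff)
    then have "norm (w - f u + B u - ybar) \<le> norm ((w - f u) - vhat) + norm (B (u - xbar))"
      by (metis norm_triangle_ineq)
    also have "\<dots> \<le> norm ((w - f u) - vhat) + norm (u - xbar) * K" using K(2) by simp
    also have "\<dots> < a + a * K"
      using u v K(1) by (intro add_less_le_mono mult_right_mono) (auto simp: dist_norm)
    finally have "dist (w - f u + B u) ybar < \<rho>'" using a(3) by (simp add: dist_norm distrib_left)
    moreover have "p (w - f u + B u) = u"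
      using p_inv[of "w - f u" u] uw(1) u v a(2) by (simp add: gph_T_iff)
    ultimately show ?thesis by (simp add: dist_commute)
  qed
  have "strongly_monotone_on (gph T \<inter> (ball xbar \<eta> \<times> ball vbar \<eta>)) \<kappa>"
    unfolding strongly_monotone_on_def
  proof clarify
    fix u1 w1 u2 w2
    assume 1: "(u1, w1) \<in> gph T" "u1 \<in> ball xbar \<eta>" "w1 \<in> ball vbar \<eta>"
      and 2: "(u2, w2) \<in> gph T" "u2 \<in> ball xbar \<eta>" "w2 \<in> ball vbar \<eta>"
    let ?h = "u1 - u2"
    define D where "D = blinfun_apply (f' xbar) ?h"
    have "(\<sigma> + 2 * \<kappa>) * (norm ?h)\<^sup>2 \<le> ?h \<bullet> (w1 - f u1 + B u1 - (w2 - f u2 + B u2))"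
      using coco[of "w1 - f u1 + B u1" "w2 - f u2 + B u2"] chart[OF 1] chart[OF 2] by simp
    also have "\<dots> = (w1 - w2) \<bullet> ?h - (f u1 - f u2 - D) \<bullet> ?h - D \<bullet> ?h + B ?h \<bullet> ?h"
      by (simp add: B.diff inner_diff_left inner_diff_right inner_add_right inner_commute)
    also have "\<dots> = (w1 - w2) \<bullet> ?h - (f u1 - f u2 - D) \<bullet> ?h + \<sigma> * (norm ?h)\<^sup>2"
      using B_quad[of ?h] by (simp add: D_def)
    finally have main: "2 * \<kappa> * (norm ?h)\<^sup>2 \<le> (w1 - w2) \<bullet> ?h - (f u1 - f u2 - D) \<bullet> ?h"
      by (simp add: distrib_right)
    have "- ((f u1 - f u2 - D) \<bullet> ?h) \<le> norm (f u1 - f u2 - D) * norm ?h"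
      using Cauchy_Schwarz_ineq2[of "f u1 - f u2 - D" ?h] by linarith
    also have "\<dots> \<le> (\<kappa> * norm ?h) * norm ?h"
      unfolding D_def using 1 2 \<eta>(2) by (intro mult_right_mono d) auto
    finally have "- ((f u1 - f u2 - D) \<bullet> ?h) \<le> \<kappa> * (norm ?h)\<^sup>2" by (simp add: power2_eq_square)
    then show "\<kappa> * (norm ?h)\<^sup>2 \<le> (w1 - w2) \<bullet> ?h" using main by linarith
  qed
  then show ?thesis using \<kappa> \<eta> by blast
qed

text \<open>
  The graph of \<open>T\<close> contains the continuous surface \<open>(p y, (y - B (p y)) + f (p y))\<close>, from which \<open>y\<close>
  can be recovered.
\<close>

lemma inverse_if_strongly_monotone:
  assumes \<kappa>: "\<kappa> > 0" and mono: "strongly_monotone_on (gph T \<inter> (U \<times> V)) \<kappa>"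
    and UV: "xbar \<in> interior U" "vbar \<in> interior V"
  shows "\<exists>W s. strongly_monotone_inverse T \<kappa> (interior U) W s \<and> xbar \<in> interior U \<and> vbar \<in> W"
proof -
  define S where "S = ball ybar \<epsilon> \<inter> p -` U0"
  define E where "E y = (y - B (p y)) + f (p y)" for y
  have p: "continuous_on S p" by (rule continuous_on_subset[OF p_continuous]) (simp add: S_def)
  have "continuous_on U0 f"
    using deriv by (intro continuous_at_imp_continuous_on ballI) (blast intro: has_derivative_continuous)
  then have "continuous_on S (\<lambda>y. f (p y))"
    by (rule continuous_on_compose2[OF _ p]) (auto simp: S_def)
  then have E: "continuous_on S E"
    unfolding E_def by (intro continuous_intros p bounded_linear.continuous_on[OF B])
  show ?thesis
  proof (rule strongly_monotone_inverse_exists[OF \<kappa> mono UV _ _ p _ E])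
    show "open S" unfolding S_def by (intro continuous_open_preimage p_continuous open_ball U0)
    show "ybar \<in> S" using ybar_mem U0 p_ybar by (simp add: S_def)
    show "p ybar = xbar" by (rule p_ybar)
    show "E ybar = vbar" by (simp add: E_def p_ybar) (simp add: ybar_def vbar_def)
    show "E y \<in> T (p y)" if "y \<in> S" for y
      using p_mem[of y] that by (auto simp: S_def T_def E_def ybar_def add.commute)
    show "inj_on (\<lambda>y. (p y, E y)) S" by (rule inj_onI) (auto simp: E_def)
  qed
qed

text \<open>
  The hypothesis on \<open>a\<close> says that \<open>(a, - q)\<close> is a proximal normal to the graph of \<open>p\<close> at \<open>(y, u)\<close>.
  The linearized change of variables \<open>y' - y = k - f' u h + B h + o(|h|)\<close>, for an increment \<open>(h, k)\<close>
  in the graph of \<open>T\<close>, turns it into the stated normal.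
\<close>

lemma frechet_normal_of_subgradient:
  assumes y: "u \<in> U0" "p y = u"
    and inv: "0 < \<delta>'" "\<And>u' v'. v' \<in> G u' \<Longrightarrow> dist u' u < \<delta>' \<Longrightarrow> dist v' (y - B u) < \<delta>' \<Longrightarrow>
      p (v' + B u') = u'"
    and sub: "0 < d" "\<And>y'. dist y' y < d \<Longrightarrow> a \<bullet> (y' - y) \<le> q \<bullet> (p y' - p y) + C * (norm (y' - y))\<^sup>2"
  shows "(B a - adjoint (blinfun_apply (f' u)) a - q, a) \<in> frechet_normal_cone (gph T) (u, f u + (y - B u))"
  unfolding frechet_normal_cone_iff
proof (intro allI impI)
  fix e :: real assume e: "0 < e"
  interpret B: bounded_linear B by (rule B)
  let ?F = "blinfun_apply (f' u)"
  define e1 where "e1 = e / 2 / (norm a + 1)"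
  have e1: "e1 > 0" "norm a * e1 \<le> e / 2"
  proof -
    have pos: "norm a + 1 > 0" by (simp add: add_nonneg_pos)
    then show e1: "e1 > 0" using e by (simp add: e1_def)
    have "e1 * (norm a + 1) = e / 2"
      using pos nonzero_eq_divide_eq[of "norm a + 1" e1 "e / 2"] by (simp add: e1_def)
    then show "norm a * e1 \<le> e / 2" using e1 by (simp add: distrib_left mult.commute)
  qed
  obtain b where b: "b > 0" "\<And>x. norm (x - u) < b \<Longrightarrow> norm (f x - f u - ?F (x - u)) \<le> e1 * norm (x - u)"
    using deriv[OF y(1)] e1(1) unfolding has_derivative_at_alt by blast
  obtain K where K: "K > 0" "\<And>x. norm (B x) \<le> norm x * K" using B.pos_bounded by blast
  define M where "M = norm (f' u)"
  \<comment> \<open>Near \<open>(u, f u + (y - B u))\<close> the chart coordinate \<open>y'\<close> of a graph point differs from \<open>y\<close> by at most \<open>N\<close> times the norm of the increment \<open>(h, k)\<close>.\<close>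
  define N where "N = 1 + (M + e1) + K"
  have M: "M \<ge> 0" by (simp add: M_def)
  have N: "N > 0" "N \<ge> 1" using M e1 K by (auto simp: N_def)
  define t where "t = min (min b (min \<delta>' d / N)) (e / (2 * (\<bar>C\<bar> * N\<^sup>2 + 1)))"
  have t: "t > 0"
    using b inv(1) sub(1) N e by (auto simp: t_def add_nonneg_pos)
  have tb: "t \<le> b" by (simp add: t_def)
  have "t \<le> min \<delta>' d / N" by (simp add: t_def)
  then have tN: "N * t \<le> \<delta>'" "N * t \<le> d" using N by (auto simp: field_simps)
  have tC: "\<bar>C\<bar> * N\<^sup>2 * t \<le> e / 2"
  proof -
    have "t \<le> e / (2 * (\<bar>C\<bar> * N\<^sup>2 + 1))" by (simp add: t_def)
    moreover have "\<bar>C\<bar> * N\<^sup>2 + 1 > 0" by (simp add: add_nonneg_pos)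
    ultimately have "t * (2 * (\<bar>C\<bar> * N\<^sup>2 + 1)) \<le> e" by (subst (asm) pos_le_divide_eq) auto
    then show ?thesis using t by (simp add: algebra_simps)
  qed
  show "\<exists>t>0. \<forall>z'\<in>gph T. dist z' (u, f u + (y - B u)) < t \<longrightarrow>
      (B a - adjoint ?F a - q, a) \<bullet> (z' - (u, f u + (y - B u))) \<le> e * norm (z' - (u, f u + (y - B u)))"
  proof (intro exI[of _ t] conjI ballI impI t)
    fix z' assume z': "z' \<in> gph T" "dist z' (u, f u + (y - B u)) < t"
    obtain x w where xw: "z' = (x, w)" by (cases z')
    define h where "h = x - u"
    define k where "k = w - (f u + (y - B u))"
    define n where "n = norm (h, k)"
    have \<Delta>: "z' - (u, f u + (y - B u)) = (h, k)" by (simp add: xw h_def k_def)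
    have n: "n < t" using z'(2) by (simp add: dist_norm \<Delta> n_def)
    have n0: "n \<ge> 0" by (simp add: n_def)
    have nh: "norm h \<le> n" and nk: "norm k \<le> n"
      using norm_fst_le[of h k] norm_snd_le[of k h] by (auto simp: n_def)
    define R where "R = f x - f u - ?F h"
    have R: "norm R \<le> e1 * n"
    proof -
      have "norm R \<le> e1 * norm h" using b(2)[of x] nh n tb by (simp add: R_def h_def)
      also have "\<dots> \<le> e1 * n" using nh e1 by simp
      finally show ?thesis .
    qed
    define v' where "v' = w - f x"
    define y' where "y' = v' + B x"
    have v': "v' \<in> G x" using z'(1) by (simp add: xw gph_T_iff v'_def)
    have vv: "v' - (y - B u) = k - (?F h + R)" by (simp add: v'_def k_def R_def)
    have "norm (?F h) \<le> M * n"
    proof -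
      have "norm (?F h) \<le> M * norm h" unfolding M_def by (rule norm_blinfun)
      also have "\<dots> \<le> M * n" using nh M by (rule mult_left_mono)
      finally show ?thesis .
    qed
    then have nv: "norm (v' - (y - B u)) \<le> (1 + (M + e1)) * n"
      unfolding vv using norm_triangle_ineq4[of k "?F h + R"] norm_triangle_ineq[of "?F h" R] R nk
      by (simp add: algebra_simps)
    have yy: "y' - y = (v' - (y - B u)) + B h" by (simp add: y'_def h_def B.diff)
    have "norm (B h) \<le> n * K" using K(2)[of h] mult_right_mono[OF nh, of K] K(1) by linarith
    then have ny: "norm (y' - y) \<le> N * n"
      unfolding yy using norm_triangle_ineq[of "v' - (y - B u)" "B h"] nv
      by (simp add: N_def algebra_simps)
    have Nn: "N * n < N * t" using n N by simp
    have "n \<le> N * n" using N n0 mult_right_mono[of 1 N n] by simp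
    then have "dist x u < \<delta>'" using nh Nn tN by (simp add: dist_norm h_def)
    moreover have "(1 + (M + e1)) * n \<le> N * n" using K n0 by (intro mult_right_mono) (auto simp: N_def)
    then have "dist v' (y - B u) < \<delta>'" using nv Nn tN by (simp add: dist_norm)
    ultimately have py': "p y' = x" using inv(2) v' by (simp add: y'_def)
    have "dist y' y < d" using ny Nn tN by (simp add: dist_norm)
    then have s: "a \<bullet> (y' - y) \<le> q \<bullet> h + C * (norm (y' - y))\<^sup>2"
      using sub(2)[of y'] unfolding py' y(2) h_def by simp
    have adj: "adjoint ?F a \<bullet> h = a \<bullet> ?F h"
      by (simp add: adjoint_clauses bounded_linear.linear[OF blinfun.bounded_linear_right])
    have "(B a - adjoint ?F a - q, a) \<bullet> (h, k) = a \<bullet> (y' - y) + a \<bullet> R - q \<bullet> h"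
      unfolding yy vv by (simp add: inner_diff_left inner_diff_right inner_add_right adj B_sym)
    also have "\<dots> \<le> C * (norm (y' - y))\<^sup>2 + a \<bullet> R" using s by simp
    also have "\<dots> \<le> e / 2 * n + e / 2 * n"
    proof (rule add_mono)
      have "C * (norm (y' - y))\<^sup>2 \<le> \<bar>C\<bar> * (norm (y' - y))\<^sup>2" by (intro mult_right_mono) auto
      also have "\<dots> \<le> \<bar>C\<bar> * (N * n)\<^sup>2" using ny by (intro mult_left_mono power_mono) auto
      also have "\<dots> = (\<bar>C\<bar> * N\<^sup>2 * n) * n" by (simp add: power_mult_distrib power2_eq_square)
      also have "\<dots> \<le> (\<bar>C\<bar> * N\<^sup>2 * t) * n" using n n0 by (intro mult_right_mono mult_left_mono) auto
      also have "\<dots> \<le> e / 2 * n" using tC n0 by (rule mult_right_mono)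
      finally show "C * (norm (y' - y))\<^sup>2 \<le> e / 2 * n" .
      have "a \<bullet> R \<le> norm a * norm R" by (rule norm_cauchy_schwarz)
      also have "\<dots> \<le> norm a * (e1 * n)" using R by (intro mult_left_mono) auto
      also have "\<dots> = (norm a * e1) * n" by simp
      also have "\<dots> \<le> e / 2 * n" using e1(2) n0 by (rule mult_right_mono)
      finally show "a \<bullet> R \<le> e / 2 * n" .
    qed
    finally show "(B a - adjoint ?F a - q, a) \<bullet> (z' - (u, f u + (y - B u)))
        \<le> e * norm (z' - (u, f u + (y - B u)))"
      unfolding \<Delta> n_def by simp
  qed
qed

text \<open>
  For \<open>l > 0\<close>, the extremal normals \<open>(l Ds k, - q k)\<close> to the graph of \<open>p\<close> become normals to the graph
  of \<open>T\<close>, with limit \<open>(z, l q0)\<close> and \<open>z = l (B q0 - (f' xbar)\<^sup>* q0) - q0\<close>.  Positive definiteness at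
  \<open>w = - l q0\<close> gives \<open>0 < \<langle>z, w\<rangle> = l (1 - \<sigma> l)\<close>, since \<open>B\<close> and the adjoint of \<open>f' xbar\<close> have quadratic
  forms differing by \<open>\<sigma> |x|\<^sup>2\<close>.
\<close>

lemma lipschitz_modulus_if_positive_definite:
  assumes pd: "positive_definite_mapping (limiting_coderivative T xbar vbar)"
  shows "\<exists>L \<rho>. L < 1 / \<sigma> \<and> \<rho> > 0 \<and> L-lipschitz_on (ball ybar \<rho>) p"
proof -
  interpret B: bounded_linear B by (rule B)
  define S where "S = {L. \<exists>\<rho>>0. L-lipschitz_on (ball ybar \<rho>) p}"
  define l where "l = Inf S"
  have "1 \<in> S" using p_lip eps by (auto simp: S_def ybar_def)
  have S0: "L \<in> S \<Longrightarrow> 0 \<le> L" for L unfolding S_def using lipschitz_on_nonneg by blast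
  have upper: "\<exists>\<rho>>0. L-lipschitz_on (ball ybar \<rho>) p" if L: "L > l" for L
  proof -
    obtain L' where "L' \<in> S" "L' < L" using L \<open>1 \<in> S\<close> cInf_lessD[of S L] by (auto simp: l_def)
    then show ?thesis unfolding S_def using lipschitz_on_mono[OF _ subset_refl less_imp_le] by blast
  qed
  have lower: "\<not> L-lipschitz_on (ball ybar \<rho>) p" if "0 \<le> L" "L < l" "\<rho> > 0" for L \<rho>
  proof
    assume "L-lipschitz_on (ball ybar \<rho>) p"
    then have "L \<in> S" using that by (auto simp: S_def)
    then have "l \<le> L" unfolding l_def using S0 by (intro cInf_lower bdd_belowI) auto
    then show False using that by simp
  qed
  have "l < 1 / \<sigma>"
  proof (cases "l > 0")
    case True
    have "\<exists>y q Ds q0. y \<longlonglongrightarrow> ybar \<and> q \<longlonglongrightarrow> q0 \<and> Ds \<longlonglongrightarrow> q0 \<and> norm q0 = 1 \<and>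
      (\<forall>k::nat. dist ybar (y k) < \<epsilon> \<and> (\<exists>C. \<exists>d>0. \<forall>y'. dist y' (y k) < d \<longrightarrow>
       l * (Ds k \<bullet> (y' - y k)) \<le> q k \<bullet> (p y' - p (y k)) + C * (norm (y' - y k))\<^sup>2))"
    proof (rule extremal_normal_sequence[where m = m])
      show "m y + p y \<bullet> (z - y) \<le> m z" if "y \<in> ball ybar \<epsilon>" "z \<in> ball ybar \<epsilon>" for y z
        by (rule p_sub) (use that in \<open>simp_all add: ybar_def\<close>)
    qed (use True upper lower eps in auto)
    then obtain y q Ds q0 where seq: "y \<longlonglongrightarrow> ybar" "q \<longlonglongrightarrow> q0" "Ds \<longlonglongrightarrow> q0" "norm q0 = 1"
      and yk: "\<And>k::nat. y k \<in> ball ybar \<epsilon>"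
      and supp: "\<And>k. \<exists>C. \<exists>d>0. \<forall>y'. dist y' (y k) < d \<longrightarrow>
       l * (Ds k \<bullet> (y' - y k)) \<le> q k \<bullet> (p y' - p (y k)) + C * (norm (y' - y k))\<^sup>2"
      unfolding mem_ball by blast
    define u where "u k = p (y k)" for k
    define v where "v k = y k - B (u k)" for k
    define a where "a k = l *\<^sub>R Ds k" for k
    have u: "u \<longlonglongrightarrow> xbar"
    proof -
      have "isCont p ybar" using p_continuous eps by (simp add: continuous_on_eq_continuous_at)
      from isCont_tendsto_compose[OF this seq(1)] show ?thesis by (simp add: u_def[abs_def] p_ybar)
    qed
    have v: "v \<longlonglongrightarrow> vhat"
    proof -
      have "v \<longlonglongrightarrow> ybar - B xbar" unfolding v_def by (intro tendsto_intros seq(1) B.tendsto u)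
      then show ?thesis by (simp add: ybar_def)
    qed
    have a: "a \<longlonglongrightarrow> l *\<^sub>R q0" unfolding a_def by (intro tendsto_intros seq(3))
    have "\<forall>\<^sub>F k in sequentially. u k \<in> U0 \<and> dist (u k) xbar < \<delta> \<and> dist (v k) vhat < \<delta>"
      using topological_tendstoD[OF u U0] tendstoD[OF u del] tendstoD[OF v del]
      by eventually_elim simp
    then obtain n where n: "\<And>k. k \<ge> n \<Longrightarrow> u k \<in> U0 \<and> dist (u k) xbar < \<delta> \<and> dist (v k) vhat < \<delta>"
      unfolding eventually_sequentially by blast
    define \<zeta> where "\<zeta> k = (B (a k) - adjoint (blinfun_apply (f' (u k))) (a k) - q k, a k)" for k
    have normal: "\<zeta> k \<in> frechet_normal_cone (gph T) (u k, f (u k) + v k)" if k: "k \<ge> n" for k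
    proof -
      obtain C d where Cd: "d > 0" "\<And>y'. dist y' (y k) < d \<Longrightarrow>
          l * (Ds k \<bullet> (y' - y k)) \<le> q k \<bullet> (p y' - p (y k)) + C * (norm (y' - y k))\<^sup>2"
        using supp[of k] by blast
      define \<delta>' where "\<delta>' = min (\<delta> - dist (u k) xbar) (\<delta> - dist (v k) vhat)"
      show ?thesis
        unfolding \<zeta>_def v_def
      proof (rule frechet_normal_of_subgradient[OF _ u_def[symmetric] _ _ Cd(1)])
        show "u k \<in> U0" "0 < \<delta>'" using n[OF k] by (auto simp: \<delta>'_def)
        show "p (v' + B u') = u'"
          if "v' \<in> G u'" "dist u' (u k) < \<delta>'" "dist v' (y k - B (u k)) < \<delta>'" for u' v'
        proof -
          have "dist u' xbar < \<delta>" using that(2) dist_triangle[of u' xbar "u k"] by (simp add: \<delta>'_def)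
          moreover have "dist v' vhat < \<delta>"
            using that(3) dist_triangle[of v' vhat "v k"] by (simp add: \<delta>'_def v_def)
          ultimately show ?thesis using p_inv that(1) by blast
        qed
        show "a k \<bullet> (y' - y k) \<le> q k \<bullet> (p y' - p (y k)) + C * (norm (y' - y k))\<^sup>2"
          if "dist y' (y k) < d" for y' using Cd(2)[OF that] by (simp add: a_def)
      qed
    qed
    have in_gph: "(u k, f (u k) + v k) \<in> gph T" for k
      using p_mem[of "y k"] yk[of k] by (simp add: gph_T_iff u_def v_def ybar_def)
    define D where "D = blinfun_apply (f' xbar)"
    define z where "z = B (l *\<^sub>R q0) - adjoint D (l *\<^sub>R q0) - q0"
    have "isCont f' xbar" using cont U0 by (simp add: continuous_on_eq_continuous_at)
    from isCont_tendsto_compose[OF this u] have F: "(\<lambda>k. f' (u k)) \<longlonglongrightarrow> f' xbar" .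
    have \<zeta>: "\<zeta> \<longlonglongrightarrow> (z, l *\<^sub>R q0)"
      unfolding \<zeta>_def z_def D_def
      by (intro tendsto_intros tendsto_adjoint_blinfun F a B.tendsto seq(2))
    have "isCont f xbar" using deriv[OF U0(2)] by (rule has_derivative_continuous)
    from isCont_tendsto_compose[OF this u] have fu: "(\<lambda>k. f (u k)) \<longlonglongrightarrow> f xbar" .
    have pts: "(\<lambda>k. (u k, f (u k) + v k)) \<longlonglongrightarrow> (xbar, vbar)"
      unfolding vbar_def by (intro tendsto_intros u v fu)
    have "(z, l *\<^sub>R q0) \<in> limiting_normal_cone (gph T) (xbar, vbar)"
      unfolding limiting_normal_cone_def
      using normal in_gph LIMSEQ_ignore_initial_segment[OF pts, of n] LIMSEQ_ignore_initial_segment[OF \<zeta>, of n]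
      by (intro CollectI exI[of _ "\<lambda>k. (u (k + n), f (u (k + n)) + v (k + n))"] exI[of _ "\<lambda>k. \<zeta> (k + n)"])
         (auto simp del: add_diff_cancel)
    then have "z \<in> limiting_coderivative T xbar vbar (- (l *\<^sub>R q0))"
      by (simp add: limiting_coderivative_def)
    moreover have "- (l *\<^sub>R q0) \<noteq> 0" using True seq(4) by auto
    ultimately have "z \<bullet> (- (l *\<^sub>R q0)) > 0" using pd unfolding positive_definite_mapping_def by blast
    moreover have "z \<bullet> (- (l *\<^sub>R q0)) = l * (1 - \<sigma> * l)"
    proof -
      have adj: "adjoint D x \<bullet> x = D x \<bullet> x" for x
        unfolding D_def
        by (simp add: adjoint_clauses bounded_linear.linear[OF blinfun.bounded_linear_right] inner_commute)
      have "z \<bullet> (- (l *\<^sub>R q0)) = - (B (l *\<^sub>R q0) \<bullet> (l *\<^sub>R q0)) + D (l *\<^sub>R q0) \<bullet> (l *\<^sub>R q0) + l * (q0 \<bullet> q0)"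
        unfolding z_def inner_minus_right inner_diff_left adj by simp
      also have "\<dots> = - \<sigma> * (norm (l *\<^sub>R q0))\<^sup>2 + l * (norm q0)\<^sup>2"
        using B_quad[of "l *\<^sub>R q0"] unfolding D_def power2_norm_eq_inner by simp
      also have "\<dots> = l * (1 - \<sigma> * l)" using seq(4) by (simp add: power2_eq_square algebra_simps)
      finally show ?thesis .
    qed
    ultimately have "0 < l * (1 - \<sigma> * l)" by (simp only:)
    then have "\<sigma> * l < 1" using True by (simp add: zero_less_mult_iff)
    then show ?thesis using sigma by (simp add: pos_less_divide_eq mult.commute)
  next
    case False
    have "0 < 1 / \<sigma>" using sigma by simp
    then show ?thesis using False by linarith
  qed
  then obtain L where "l < L" "L < 1 / \<sigma>" using dense by blast
  then show ?thesis using upper by blast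
qed

lemma strongly_maximally_monotone_iff_positive_definite:
  "locally_strongly_maximally_monotone T xbar vbar \<longleftrightarrow>
    positive_definite_mapping (limiting_coderivative T xbar vbar)"
proof
  assume "locally_strongly_maximally_monotone T xbar vbar"
  then obtain \<kappa> U V where "\<kappa> > 0" "xbar \<in> interior U" "vbar \<in> interior V"
    "strongly_monotone_on (gph T \<inter> (U \<times> V)) \<kappa>"
    unfolding locally_strongly_maximally_monotone_def strongly_monotone_on_def by blast
  then obtain W s where "strongly_monotone_inverse T \<kappa> (interior U) W s" "xbar \<in> interior U" "vbar \<in> W"
    using inverse_if_strongly_monotone by blast
  then show "positive_definite_mapping (limiting_coderivative T xbar vbar)"
    by (rule strongly_monotone_inverse.coderivative_positive_definite)
next
  assume "positive_definite_mapping (limiting_coderivative T xbar vbar)"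
  then obtain L \<rho> where "L < 1 / \<sigma>" "\<rho> > 0" "L-lipschitz_on (ball ybar \<rho>) p"
    using lipschitz_modulus_if_positive_definite by blast
  then obtain \<kappa> \<eta> where \<kappa>: "\<kappa> > 0" "\<eta> > 0"
    "strongly_monotone_on (gph T \<inter> (ball xbar \<eta> \<times> ball vbar \<eta>)) \<kappa>"
    using strongly_monotone_if_lipschitz by blast
  have "xbar \<in> interior (ball xbar \<eta>)" "vbar \<in> interior (ball vbar \<eta>)"
    using \<kappa> by (auto simp: interior_open)
  then obtain W s where "strongly_monotone_inverse T \<kappa> (interior (ball xbar \<eta>)) W s"
      "xbar \<in> interior (ball xbar \<eta>)" "vbar \<in> W"
    using inverse_if_strongly_monotone[OF \<kappa>(1,3)] by blast
  then show "locally_strongly_maximally_monotone T xbar vbar"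
    by (rule strongly_monotone_inverse.locally_strongly_maximally_monotone)
qed

end

section \<open>The equivalence\<close>

theorem corollary4p8:
  fixes f :: "'a::euclidean_space \<Rightarrow> 'a"
    and g :: "'a \<Rightarrow> ereal"
    and xbar vhat :: 'a
  assumes "continuously_differentiable_around f xbar"
    and "\<forall>x. g x \<noteq> - \<infinity>"
    and "lower_semicontinuous g"
    and "vhat \<in> limiting_subdifferential g xbar"
    and "prox_regular g xbar vhat"
    and "subdifferentially_continuous g xbar vhat"
  shows "let T = (\<lambda>x. {f x + v | v. v \<in> limiting_subdifferential g x});
             vbar = f xbar + vhat
         in locally_strongly_maximally_monotone T xbar vbar \<longleftrightarrow>
            positive_definite_mapping (limiting_coderivative T xbar vbar)"
proof -
  obtain U0 and f' :: "'a \<Rightarrow> 'a \<Rightarrow>\<^sub>L 'a" where f': "open U0" "xbar \<in> U0"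
    "\<And>x. x \<in> U0 \<Longrightarrow> (f has_derivative blinfun_apply (f' x)) (at x)" "continuous_on U0 f'"
    using assms(1) unfolding continuously_differentiable_around_def by blast
  obtain r \<rho> where r: "\<rho> > 0"
    "\<And>u v x. u \<in> cball xbar \<rho> \<Longrightarrow> v \<in> limiting_subdifferential g u \<Longrightarrow> dist v vhat < \<rho> \<Longrightarrow>
      x \<in> cball xbar \<rho> \<Longrightarrow> g x \<ge> g u + ereal (v \<bullet> (x - u) - r / 2 * (norm (x - u))\<^sup>2)"
    using prox_regular_uniform_growth[OF assms(2,5,6)] by blast
  obtain \<sigma> B where B: "\<sigma> > 0" "bounded_linear B" "\<And>x y. B x \<bullet> y = x \<bullet> B y"
    "\<And>x. B x \<bullet> x = blinfun_apply (f' xbar) x \<bullet> x + \<sigma> * (norm x)\<^sup>2"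
    "\<And>x. (r + 1) * (norm x)\<^sup>2 \<le> B x \<bullet> x"
    using symmetric_part_shift[OF blinfun.bounded_linear_right, of "f' xbar" r] by blast
  obtain p m \<epsilon> \<delta> where R: "local_resolvent (limiting_subdifferential g) B p m xbar vhat \<epsilon> \<delta>"
    using local_resolvent_exists[OF assms(2,3,4) r B(2,3,5)] by blast
  interpret smoothly_perturbed_resolvent "limiting_subdifferential g" B p m xbar vhat \<epsilon> \<delta> f f' U0 \<sigma>
    by (intro smoothly_perturbed_resolvent.intro R smoothly_perturbed_resolvent_axioms.intro f' B)
  show ?thesis
    using strongly_maximally_monotone_iff_positive_definite by (simp only: Let_def T_def vbar_def)
qed

end
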